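(* Let $m\geq1$ and $d>0$ be integers and let $M$ be a subset of $\mathbb N^m$. Suppose that there exist two distinct elements $\xi,\zeta\in M$ of degree at most $d$, incomparable in the product order and with $\deg\mathrm{LUB}(\xi,\zeta)>d+1$, that are not $\mathrm{LUB}(\xi,\zeta)_{d,M}$-connected. Then $$H_M(d+1)<H_M(d)^{\langle d\rangle}.$$
   Context: $\mathbb N=\{0,1,2,\dots\}$; $\leq$ denotes the product order on $\mathbb N^m$; $\deg(u_1,\dots,u_m)=u_1+\cdots+u_m$; $\mathrm{LUB}(\xi,\zeta)$ is the entrywise maximum of $\xi$ and $\zeta$; $\Gamma(d)=\{\xi\in\mathbb N^m:\deg\xi\leq d\}$. Connectedness. Given $\tau\in\mathbb N^m$ with $\deg\tau>d+1$ and distinct $\xi,\zeta\in M\cap\Gamma(d)$, both $<\tau$, we say that $\xi$ and $\zeta$ are $\tau_{d,M}$-connected if there is a sequence $\eta_1,\dots,\eta_s$ of elements of $M\cap\Gamma(d)$, all $<\tau$, with $\eta_1=\xi$, $\eta_s=\zeta$ and $\deg\mathrm{LUB}(\eta_i,\eta_{i+1})\leq d+1$ for all $1\leq i\leq s-1$. Hilbert-Samuel function: $H_M(d)=|\{\xi\in\mathbb N^m:\deg\xi=d\text{ and }\xi\not\geq\eta\text{ for all }\eta\in M\}|$. Macaulay's operation: for positive integers $a,d$, write $a$ uniquely as $a=\binom{k_d}{d}+\binom{k_{d-1}}{d-1}+\cdots+\binom{k_j}{j}$ with $k_d>k_{d-1}>\cdots>k_j\geq j\geq1$, and set $a^{\langle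 d\rangle}=\binom{k_d+1}{d+1}+\binom{k_{d-1}+1}{d}+\cdots+\binom{k_j+1}{j+1}$; also $0^{\langle d\rangle}=0$. *)

theory Defs
  imports Complex_Main
begin

text \<open>
  A point of $\mathbb{N}^m$ is a function on \<^typ>\<open>nat\<close> with coordinates \<open>0, \<dots>, m - 1\<close>
  that vanishes at every index \<open>\<ge> m\<close>. On such functions the pointwise order of the library
  is the product order (so \<open><\<close> means \<open>\<le>\<close> and \<open>\<noteq>\<close>), and \<^const>\<open>sup\<close> is the entrywise
  maximum, i.e. LUB.
\<close>

definition Nvec :: "nat \<Rightarrow> (nat \<Rightarrow> nat) set" where
  "Nvec m = {\<xi>. \<forall>i\<ge>m. \<xi> i = 0}"

definition deg :: "nat \<Rightarrow> (nat \<Rightarrow> nat) \<Rightarrow> nat" where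
  "deg m \<xi> = (\<Sum>i<m. \<xi> i)"

definition Gam :: "nat \<Rightarrow> nat \<Rightarrow> (nat \<Rightarrow> nat) set" where
  "Gam m d = {\<xi> \<in> Nvec m. deg m \<xi> \<le> d}"

definition hilbert_samuel :: "nat \<Rightarrow> (nat \<Rightarrow> nat) set \<Rightarrow> nat \<Rightarrow> nat" where
  "hilbert_samuel m M d = card {\<xi> \<in> Nvec m. deg m \<xi> = d \<and> (\<forall>\<eta>\<in>M. \<not> \<xi> \<ge> \<eta>)}"

definition tau_connected ::
  "nat \<Rightarrow> nat \<Rightarrow> (nat \<Rightarrow> nat) set \<Rightarrow> (nat \<Rightarrow> nat) \<Rightarrow> (nat \<Rightarrow> nat) \<Rightarrow> (nat \<Rightarrow> nat) \<Rightarrow> bool" where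
  "tau_connected m d M \<tau> \<xi> \<zeta> \<longleftrightarrow>
     (\<exists>(s::nat) \<eta>. 1 \<le> s \<and>
        (\<forall>i\<in>{1..s}. \<eta> i \<in> M \<inter> Gam m d \<and> \<eta> i < \<tau>) \<and>
        \<eta> 1 = \<xi> \<and> \<eta> s = \<zeta> \<and>
        (\<forall>i. 1 \<le> i \<and> i \<le> s - 1 \<longrightarrow> deg m (sup (\<eta> i) (\<eta> (i + 1))) \<le> d + 1))"

definition macaulay_rep :: "nat \<Rightarrow> nat \<Rightarrow> nat \<Rightarrow> (nat \<Rightarrow> nat) \<Rightarrow> bool" where
  "macaulay_rep d a j k \<longleftrightarrow>
     1 \<le> j \<and> j \<le> d \<and> j \<le> k j \<and> (\<forall>i\<in>{j..<d}. k i < k (Suc i)) \<and>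
     a = (\<Sum>i=j..d. k i choose i)"

definition macaulay_op :: "nat \<Rightarrow> nat \<Rightarrow> nat" where
  "macaulay_op a d =
     (if a = 0 then 0
      else THE b. \<exists>j k. macaulay_rep d a j k \<and> b = (\<Sum>i=j..d. (k i + 1) choose (i + 1)))"

text \<open>
  Existence and uniqueness of the representation for \<open>a, d > 0\<close>, so that the description
  operator above is well-defined; only the values of \<open>k\<close> on \<open>{j..d}\<close> are determined.
\<close>

lemma macaulay_rep_cases:
  assumes "macaulay_rep d a j k"
  obtains "j = d" "a = k d choose d" "d \<le> k d" "1 \<le> d"
  | d' a' where "d = Suc d'" "j \<le> d'" "a = (k d choose d) + a'" "macaulay_rep d' a' j k" "k d' < k d"
proof (cases "j = d")
  case True
  then show ?thesis using assms that(1) by (simp add: macaulay_rep_def)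
next
  case False
  then obtain d' where d: "d = Suc d'" "j \<le> d'"
    using assms by (cases d) (auto simp: macaulay_rep_def)
  have "(\<Sum>i=j..d. k i choose i) = (k d choose d) + (\<Sum>i=j..d'. k i choose i)"
    using d by simp
  then show ?thesis
    using that(2)[OF d, of "\<Sum>i=j..d'. k i choose i"] assms d
    by (auto simp: macaulay_rep_def)
qed

lemma macaulay_rep_bounds:
  "macaulay_rep d a j k \<Longrightarrow> d \<le> k d \<and> 0 < a \<and> k d choose d \<le> a \<and> a < Suc (k d) choose d"
proof (induction d arbitrary: a)
  case 0
  then show ?case by (auto simp: macaulay_rep_def)
next
  case (Suc d)
  from Suc.prems show ?case
  proof (cases rule: macaulay_rep_cases)
    case 1
    then show ?thesis by (simp add: zero_less_binomial)
  next
    case (2 d' a')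
    then have IH: "d \<le> k d" "0 < a'" "a' < Suc (k d) choose d" using Suc.IH by auto
    have "Suc (k d) choose d \<le> k (Suc d) choose d"
      using 2 by (intro binomial_right_mono) auto
    then show ?thesis using IH 2 by simp
  qed
qed

lemma macaulay_rep_unique:
  assumes "macaulay_rep d a j k" "macaulay_rep d a j' k'"
  shows "j = j' \<and> (\<forall>i\<in>{j..d}. k i = k' i)"
  using assms
proof (induction d arbitrary: a)
  case 0
  then show ?case by (auto simp: macaulay_rep_def)
next
  case (Suc d)
  have le: "f (Suc d) \<le> g (Suc d)"
    if "macaulay_rep (Suc d) a i f" "macaulay_rep (Suc d) a l g" for f g i l
  proof (rule ccontr)
    assume "\<not> ?thesis"
    then have "Suc (g (Suc d)) choose Suc d \<le> f (Suc d) choose Suc d"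
      by (intro binomial_right_mono) auto
    then show False
      using macaulay_rep_bounds[OF that(1)] macaulay_rep_bounds[OF that(2)] by linarith
  qed
  have top: "k (Suc d) = k' (Suc d)"
    using le[OF Suc.prems] le[OF Suc.prems(2) Suc.prems(1)] by simp
  from Suc.prems(1) show ?case
  proof (cases rule: macaulay_rep_cases)
    case 1
    note first = this
    from Suc.prems(2) show ?thesis
    proof (cases rule: macaulay_rep_cases)
      case 1
      with \<open>j = Suc d\<close> top show ?thesis by simp
    next
      case (2 e b)
      have "a = k' (Suc d) choose Suc d" unfolding top[symmetric] by (rule first(2))
      moreover have "0 < b" using macaulay_rep_bounds[OF 2(4)] by blast
      ultimately show ?thesis using 2(3) by linarith
    qed
  next
    case (2 e b)
    note first = this
    from Suc.prems(2) show ?thesis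
    proof (cases rule: macaulay_rep_cases)
      case 1
      have "a = k (Suc d) choose Suc d" unfolding top by (rule 1(2))
      moreover have "0 < b" using macaulay_rep_bounds[OF first(4)] by blast
      ultimately show ?thesis using first(3) by linarith
    next
      case (2 e' b')
      have "b = b'" using first(3) 2(3) unfolding top by linarith
      then have "macaulay_rep d b j k" "macaulay_rep d b j' k'" using first(1,4) 2(1,4) by auto
      then have "j = j' \<and> (\<forall>i\<in>{j..d}. k i = k' i)" by (rule Suc.IH)
      then show ?thesis using top by (auto simp: le_Suc_eq)
    qed
  qed
qed

lemma macaulay_rep_exists:
  assumes "0 < a" "0 < d"
  shows "\<exists>j k. macaulay_rep d a j k"
  using assms
proof (induction d arbitrary: a)
  case 0
  then show ?case by simp
next
  case (Suc d)
  define P where "P K \<longleftrightarrow> K choose Suc d \<le> a" for K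
  have bound: "K \<le> a + d" if "P K" for K
  proof (rule ccontr)
    assume "\<not> ?thesis"
    then have "(a + Suc d) choose Suc d \<le> K choose Suc d" by (intro binomial_right_mono) auto
    moreover have "a < (a + Suc d) choose Suc d"
    proof (induction a)
      case (Suc a)
      have "0 < Suc (a + d) choose d" by (simp add: zero_less_binomial del: binomial_Suc_Suc)
      moreover have "(Suc a + Suc d) choose Suc d = (Suc (a + d) choose d) + ((a + Suc d) choose Suc d)"
        by (simp del: binomial_Suc_Suc add: binomial_Suc_Suc[of "Suc (a + d)" d])
      ultimately show ?case using Suc.IH by linarith
    qed simp
    ultimately show False using that by (simp add: P_def)
  qed
  have base: "P (Suc d)" using Suc.prems by (simp add: P_def)
  define K where "K = (GREATEST K. P K)"
  have PK: "P K" unfolding K_def using base bound by (rule GreatestI_nat)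
  have K: "Suc d \<le> K" unfolding K_def using base bound by (rule Greatest_le_nat)
  have "\<not> P (Suc K)"
    using Greatest_le_nat[of P "Suc K", OF _ bound] by (auto simp: K_def[symmetric])
  then have r: "a - (K choose Suc d) < K choose d" using PK by (simp add: P_def)
  show ?case
  proof (cases "a = K choose Suc d")
    case True
    then have "macaulay_rep (Suc d) a (Suc d) (\<lambda>_. K)" using K by (simp add: macaulay_rep_def)
    then show ?thesis by blast
  next
    case False
    then have pos: "0 < a - (K choose Suc d)" using PK by (simp add: P_def)
    with r have "0 < d" by (cases d) auto
    then obtain j k where jk: "macaulay_rep d (a - (K choose Suc d)) j k"
      using Suc.IH pos by blast
    have less: "k d < K"
    proof (rule ccontr)
      assume "\<not> ?thesis"
      then have "K choose d \<le> k d choose d" by (intro binomial_right_mono) auto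
      then show False using macaulay_rep_bounds[OF jk] r by linarith
    qed
    have "(\<Sum>i=j..d. (k(Suc d := K)) i choose i) = (\<Sum>i=j..d. k i choose i)"
      by (intro sum.cong) auto
    then have "macaulay_rep (Suc d) a j (k(Suc d := K))"
      using jk less PK pos by (auto simp: macaulay_rep_def less_Suc_eq)
    then show ?thesis by blast
  qed
qed

lemma macaulay_op_eq:
  assumes "macaulay_rep d a j k"
  shows "macaulay_op a d = (\<Sum>i=j..d. (k i + 1) choose (i + 1))"
proof -
  have "(THE b. \<exists>j k. macaulay_rep d a j k \<and> b = (\<Sum>i=j..d. (k i + 1) choose (i + 1)))
      = (\<Sum>i=j..d. (k i + 1) choose (i + 1))"
  proof (rule the_equality)
    fix b
    assume "\<exists>j k. macaulay_rep d a j k \<and> b = (\<Sum>i=j..d. (k i + 1) choose (i + 1))"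
    then obtain j' k' where *: "macaulay_rep d a j' k'"
      "b = (\<Sum>i=j'..d. (k' i + 1) choose (i + 1))" by blast
    show "b = (\<Sum>i=j..d. (k i + 1) choose (i + 1))"
      using macaulay_rep_unique[OF *(1) assms] *(2) by (auto intro: sum.cong)
  qed (use assms in blast)
  then show ?thesis using macaulay_rep_bounds[OF assms] by (simp add: macaulay_op_def)
qed

end

theory Submission
  imports Defs
begin

text \<open>
  Let \<open>A\<close> be the set of monomials of degree \<open>d\<close> that are divisible by an element of \<open>M\<close>. Macaulay's
  theorem says that the shadow of \<open>A\<close> (its multiples of degree \<open>d + 1\<close>) is at least as large as that
  of the lexicographic segment with \<open>card A\<close> elements, and for the segment the number of monomials
  outside the shadow is given by Macaulay's operation. So it is enough to show that a set with the
  smallest possible shadow is connected below every \<open>\<tau>\<close>, through steps that exchange one variable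
  for another; such a path between multiples of \<open>\<xi>\<close> and \<open>\<zeta>\<close> of degree \<open>d\<close> below LUB gives the path
  in \<open>M\<close>.

  Connectedness goes by induction on the number of variables. Slice \<open>A\<close> by the exponent \<open>k\<close> of the
  last variable. Replacing every slice \<open>A\<^sub>k\<close> by a lexicographic segment \<open>L\<^sub>k\<close> cannot make the shadow
  smaller, so each slice of the shadow of \<open>A\<close> has exactly \<open>max |S L\<^bsub>k+1\<^esub>| |A\<^sub>k|\<close> elements
  (\<open>S\<close> is the shadow). Hence
  either \<open>A\<^sub>k\<close> lies in the shadow of \<open>A\<^bsub>k+1\<^esub>\<close>, and \<open>A\<^bsub>k+1\<^esub>\<close> again has minimal shadow, or the shadow
  of \<open>A\<^bsub>k+1\<^esub>\<close> lies in \<open>A\<^sub>k\<close>: all elements of one of the two slices can be moved into the other. A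
  compression in two variables shows that the moves go up below some slice and down above it, so
  that any two elements can be moved into a common slice, where the induction hypothesis applies.
\<close>

section \<open>Monomials of fixed degree, multiplication and division by one variable,
  shadows\<close>

definition mons :: "nat \<Rightarrow> nat \<Rightarrow> (nat \<Rightarrow> nat) set" where
  "mons m d = {u \<in> Nvec m. deg m u = d}"

definition inc :: "nat \<Rightarrow> (nat \<Rightarrow> nat) \<Rightarrow> nat \<Rightarrow> nat" where
  "inc i u = u(i := Suc (u i))"

definition dec :: "nat \<Rightarrow> (nat \<Rightarrow> nat) \<Rightarrow> nat \<Rightarrow> nat" where
  "dec i u = u(i := u i - 1)"

definition shadow :: "nat \<Rightarrow> (nat \<Rightarrow> nat) set \<Rightarrow> (nat \<Rightarrow> nat) set" where
  "shadow m A = (\<Union>i<m. inc i ` A)"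

lemma inc_apply: "inc i u k = (if k = i then Suc (u i) else u k)"
  by (simp add: inc_def)

lemma dec_apply: "dec i u k = (if k = i then u i - 1 else u k)"
  by (simp add: dec_def)

lemma dec_inc [simp]: "dec i (inc i u) = u"
  by (auto simp: inc_def dec_def)

lemma inc_dec [simp]: "0 < u i \<Longrightarrow> inc i (dec i u) = u"
  by (auto simp: inc_def dec_def)

lemma inj_inc: "inj (inc i)"
  by (metis dec_inc injI)

lemma inc_in_Nvec: "i < m \<Longrightarrow> u \<in> Nvec m \<Longrightarrow> inc i u \<in> Nvec m"
  by (auto simp: Nvec_def inc_def)

lemma dec_in_Nvec: "u \<in> Nvec m \<Longrightarrow> dec i u \<in> Nvec m"
  by (auto simp: Nvec_def dec_def)

lemma deg_inc: "i < m \<Longrightarrow> deg m (inc i u) = Suc (deg m u)"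
  by (simp add: deg_def inc_def sum.remove[of "{..<m}" i])

lemma deg_mono: "(\<And>i. i < m \<Longrightarrow> u i \<le> v i) \<Longrightarrow> deg m u \<le> deg m v"
  unfolding deg_def by (rule sum_mono) auto

lemma deg_Suc [simp]: "deg (Suc m) u = deg m u + u m"
  by (simp add: deg_def)

lemma deg_upd [simp]: "m \<le> k \<Longrightarrow> deg m (u(k := a)) = deg m u"
  unfolding deg_def by (rule sum.cong) auto

lemma le_deg: "i < m \<Longrightarrow> u i \<le> deg m u"
  unfolding deg_def by (rule member_le_sum) auto

lemma finite_mons [simp, intro]: "finite (mons m d)"
proof (rule finite_subset)
  show "mons m d \<subseteq> {f. \<forall>x. (x \<in> {..<m} \<longrightarrow> f x \<in> {..d}) \<and> (x \<notin> {..<m} \<longrightarrow> f x = 0)}"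
    using le_deg by (auto simp: mons_def Nvec_def not_less)
qed (rule finite_set_of_finite_funs; simp)

lemma mons_inc: "u \<in> mons m d \<Longrightarrow> i < m \<Longrightarrow> inc i u \<in> mons m (Suc d)"
  by (simp add: mons_def inc_in_Nvec deg_inc)

lemma mons_incD: "inc i u \<in> mons m (Suc d) \<Longrightarrow> i < m \<Longrightarrow> u \<in> mons m d"
  using dec_in_Nvec[of "inc i u" m i] by (auto simp: mons_def deg_inc)

lemma mons_dec:
  assumes "u \<in> mons m (Suc d)" "i < m" "0 < u i"
  shows "dec i u \<in> mons m d"
  using mons_incD[of i "dec i u" m d] assms by simp

lemma mons_0 [simp]: "mons m 0 = {\<lambda>_. 0}"
proof -
  have "u = (\<lambda>_. 0)" if "u \<in> mons m 0" for u
  proof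
    fix i show "u i = 0"
      using that le_deg[of i m u] by (cases "i < m") (auto simp: mons_def Nvec_def)
  qed
  moreover have "(\<lambda>_. 0) \<in> mons m 0" by (simp add: mons_def Nvec_def deg_def)
  ultimately show ?thesis by blast
qed

lemma mons_zero_outside: "u \<in> mons m d \<Longrightarrow> m \<le> i \<Longrightarrow> u i = 0"
  by (simp add: mons_def Nvec_def)

lemma mons_pos_less: "u \<in> mons m d \<Longrightarrow> 0 < u i \<Longrightarrow> i < m"
  by (metis mons_zero_outside not_less less_irrefl)

lemma mons_deg: "u \<in> mons m d \<Longrightarrow> deg m u = d"
  by (simp add: mons_def)

lemma mons_ex_pos:
  assumes "u \<in> mons m (Suc d)" obtains i where "i < m" "0 < u i"
proof -
  have "(\<Sum>i<m. u i) \<noteq> 0" using mons_deg[OF assms] by (simp add: deg_def)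
  then have "\<exists>i\<in>{..<m}. u i \<noteq> 0" by (meson sum.neutral)
  then show ?thesis using that by auto
qed

lemma mons_eqI:
  assumes "u \<in> mons m d" "v \<in> mons m d" "\<And>i. i < m \<Longrightarrow> u i \<le> v i"
  shows "u = v"
proof
  fix i
  have "sum u {..<m} = sum v {..<m}" using assms(1,2) by (simp add: mons_def deg_def)
  then have "\<forall>i\<in>{..<m}. u i = v i"
    using sum_mono_inv[of u "{..<m}" v] assms(3) by auto
  then show "u i = v i"
    using assms(1,2) by (cases "i < m") (auto simp: mons_zero_outside)
qed

lemma shadowI: "u \<in> A \<Longrightarrow> i < m \<Longrightarrow> inc i u \<in> shadow m A"
  by (auto simp: shadow_def)

lemma shadowE:
  assumes "u \<in> shadow m A" obtains i v where "i < m" "v \<in> A" "u = inc i v"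
  using assms by (auto simp: shadow_def)

lemma shadow_mons: "A \<subseteq> mons m d \<Longrightarrow> shadow m A \<subseteq> mons m (Suc d)"
  by (auto elim!: shadowE intro: mons_inc)

lemma shadow_empty [simp]: "shadow m {} = {}"
  by (simp add: shadow_def)

lemma finite_shadow: "A \<subseteq> mons m d \<Longrightarrow> finite (shadow m A)"
  by (meson finite_mons finite_subset shadow_mons)

section \<open>Lexicographic segments\<close>

text \<open>The smallest index is the most significant, so variable 0 is the largest variable.
  Monomials of different degrees are compared as well.\<close>

definition lexless :: "(nat \<Rightarrow> nat) \<Rightarrow> (nat \<Rightarrow> nat) \<Rightarrow> bool" where
  "lexless u v \<longleftrightarrow> (\<exists>c. u c < v c \<and> (\<forall>i<c. u i = v i))"

definition lexseg :: "nat \<Rightarrow> nat \<Rightarrow> (nat \<Rightarrow> nat) set \<Rightarrow> bool" where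
  "lexseg m d L \<longleftrightarrow> L \<subseteq> mons m d \<and> (\<forall>u\<in>L. \<forall>v\<in>mons m d. lexless u v \<longrightarrow> v \<in> L)"

lemma lexless_irrefl [simp]: "\<not> lexless u u"
  by (simp add: lexless_def)

lemma lexless_linear: "lexless u v \<or> u = v \<or> lexless v u"
proof (cases "u = v")
  case False
  define c where "c = (LEAST i. u i \<noteq> v i)"
  have "\<exists>i. u i \<noteq> v i" using False by auto
  then have "u c \<noteq> v c" unfolding c_def by (rule LeastI_ex)
  moreover have "u i = v i" if "i < c" for i
    using not_less_Least that unfolding c_def by blast
  ultimately show ?thesis unfolding lexless_def
    by (cases "u c" "v c" rule: linorder_cases) auto
qed simp

lemma lexless_trans:
  assumes "lexless u v" "lexless v w" shows "lexless u w"
proof -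
  obtain c where c: "u c < v c" "\<forall>i<c. u i = v i" using assms(1) by (auto simp: lexless_def)
  obtain e where e: "v e < w e" "\<forall>i<e. v i = w i" using assms(2) by (auto simp: lexless_def)
  have "u (min c e) < w (min c e)"
    using c e by (cases c e rule: linorder_cases) (auto simp: min_def)
  moreover have "\<forall>i<min c e. u i = w i" using c e by auto
  ultimately show ?thesis by (auto simp: lexless_def)
qed

lemma lexless_asym: "lexless u v \<Longrightarrow> \<not> lexless v u"
  using lexless_trans lexless_irrefl by blast

lemma lexless_inc: "lexless u v \<longleftrightarrow> lexless (inc i u) (inc i v)"
  by (auto simp: lexless_def inc_apply)

lemma lexsegD: "lexseg m d L \<Longrightarrow> u \<in> L \<Longrightarrow> v \<in> mons m d \<Longrightarrow> lexless u v \<Longrightarrow> v \<in> L"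
  by (auto simp: lexseg_def)

lemma lexseg_mons: "lexseg m d L \<Longrightarrow> L \<subseteq> mons m d"
  by (auto simp: lexseg_def)

lemma lexseg_finite: "lexseg m d L \<Longrightarrow> finite L"
  by (meson finite_mons finite_subset lexseg_mons)

lemma lexseg_empty [simp]: "lexseg m d {}"
  by (simp add: lexseg_def)

lemma lexseg_not_in: "lexseg m d L \<Longrightarrow> u \<in> L \<Longrightarrow> v \<in> mons m d \<Longrightarrow> v \<notin> L \<Longrightarrow> lexless v u"
  by (metis lexless_linear lexsegD)

lemma lexseg_nested: "lexseg m d L \<Longrightarrow> lexseg m d K \<Longrightarrow> L \<subseteq> K \<or> K \<subseteq> L"
  by (meson lexsegD lexseg_mons lexseg_not_in subset_iff)

lemma lexseg_card_subset:
  assumes "lexseg m d L" "lexseg m d K" "card L \<le> card K" shows "L \<subseteq> K"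
  by (metis assms card_seteq lexseg_finite lexseg_nested subset_refl)

lemma lexless_max:
  assumes "finite A" "A \<noteq> {}"
  obtains u where "u \<in> A" "\<And>v. v \<in> A \<Longrightarrow> v = u \<or> lexless v u"
  using assms
proof (induction A arbitrary: thesis rule: finite_ne_induct)
  case (singleton x)
  then show ?case by blast
next
  case (insert x F)
  obtain u where u: "u \<in> F" "\<And>v. v \<in> F \<Longrightarrow> v = u \<or> lexless v u" using insert.IH by blast
  consider "lexless u x" | "x = u \<or> lexless x u" using lexless_linear by blast
  then show ?case
  proof cases
    case 1
    then show ?thesis using u insert.prems[of x] lexless_trans by (metis insert_iff)
  next
    case 2
    then show ?thesis using u insert.prems[of u] by blast
  qed
qed

lemma lexless_min:
  assumes "finite A" "A \<noteq> {}"
  obtains u where "u \<in> A" "\<And>v. v \<in> A \<Longrightarrow> v = u \<or> lexless u v"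
  using assms
proof (induction A arbitrary: thesis rule: finite_ne_induct)
  case (singleton x)
  then show ?case by blast
next
  case (insert x F)
  obtain u where u: "u \<in> F" "\<And>v. v \<in> F \<Longrightarrow> v = u \<or> lexless u v" using insert.IH by blast
  consider "lexless x u" | "x = u \<or> lexless u x" using lexless_linear by blast
  then show ?case
  proof cases
    case 1
    then show ?thesis using u insert.prems[of x] lexless_trans by (metis insert_iff)
  next
    case 2
    then show ?thesis using u insert.prems[of u] by blast
  qed
qed

text \<open>A segment that is not everything is determined by the largest monomial it misses. Adding
  this monomial gives the next segment, and any segment not contained in the given one must contain
  it.\<close>

definition first_out :: "nat \<Rightarrow> nat \<Rightarrow> (nat \<Rightarrow> nat) set \<Rightarrow> (nat \<Rightarrow> nat) \<Rightarrow> bool" where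
  "first_out m d L u \<longleftrightarrow> u \<in> mons m d \<and> L = {v \<in> mons m d. lexless u v}"

lemma first_out_ex:
  assumes "lexseg m d L" "L \<noteq> mons m d"
  obtains u where "first_out m d L u"
proof -
  have "mons m d - L \<noteq> {}" using assms by (auto simp: lexseg_def)
  then obtain u where u: "u \<in> mons m d - L" "\<And>v. v \<in> mons m d - L \<Longrightarrow> v = u \<or> lexless v u"
    using lexless_max[of "mons m d - L"] by blast
  have "L = {v \<in> mons m d. lexless u v}"
  proof (intro set_eqI iffI)
    fix v assume "v \<in> L"
    then show "v \<in> {v \<in> mons m d. lexless u v}"
      using u(1) lexseg_not_in[OF assms(1)] lexseg_mons[OF assms(1)] by auto
  next
    fix v assume v: "v \<in> {v \<in> mons m d. lexless u v}"
    then have "\<not> (v = u \<or> lexless v u)" using lexless_asym lexless_irrefl by blast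
    then show "v \<in> L" using v u(2)[of v] by blast
  qed
  then show ?thesis using that u by (auto simp: first_out_def)
qed

lemma first_out_notin: "first_out m d L u \<Longrightarrow> u \<notin> L"
  by (auto simp: first_out_def)

lemma first_out_lexseg: "first_out m d L u \<Longrightarrow> lexseg m d L"
  using lexless_trans by (auto simp: first_out_def lexseg_def)

lemma first_out_insert:
  assumes "first_out m d L u" shows "lexseg m d (insert u L)"
  using assms lexless_trans by (auto simp: first_out_def lexseg_def)

lemma lexseg_first_out_in:
  assumes "first_out m d L u" "lexseg m d K" "\<not> K \<subseteq> L" shows "u \<in> K"
proof -
  obtain v where "v \<in> K" "v \<notin> L" using assms(3) by blast
  moreover from this have "v \<in> mons m d" using assms(2) lexseg_mons by blast
  ultimately have "v = u \<or> lexless v u"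
    using assms(1) lexless_linear unfolding first_out_def by blast
  then show ?thesis using \<open>v \<in> K\<close> assms(1,2) lexsegD unfolding first_out_def by blast
qed

lemma lexseg_exists:
  assumes "n \<le> card (mons m d)" shows "\<exists>L. lexseg m d L \<and> card L = n"
  using assms
proof (induction n)
  case 0
  then show ?case using lexseg_empty by (metis card.empty)
next
  case (Suc n)
  then obtain L where L: "lexseg m d L" "card L = n" by auto
  then have "L \<noteq> mons m d" using Suc.prems by auto
  then obtain u where u: "first_out m d L u" using first_out_ex L by blast
  then have "card (insert u L) = Suc n"
    using L first_out_notin lexseg_finite by (metis card_insert_disjoint)
  then show ?case using first_out_insert u by blast
qed

lemma deg_eq_prefix:
  assumes "c \<le> m" "\<And>i. c \<le> i \<Longrightarrow> i < m \<Longrightarrow> u i = 0"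
  shows "deg m u = deg c u"
  unfolding deg_def by (rule sum.mono_neutral_right) (use assms in auto)

lemma deg_prefix_le: "c \<le> m \<Longrightarrow> deg c u \<le> deg m u"
  unfolding deg_def by (rule sum_mono2) auto

lemma deg_cong: "(\<And>i. i < m \<Longrightarrow> u i = v i) \<Longrightarrow> deg m u = deg m v"
  by (simp add: deg_def)

text \<open>The first difference is at or before \<open>j\<close>, since \<open>v\<close> vanishes
  after \<open>j\<close>. Division by \<open>j\<close> changes only entry \<open>j\<close>, so the
  inequality is lost only if the first difference is at \<open>j\<close> and equals 1.\<close>

lemma lexless_dec:
  assumes "0 < v j" "lexless u v" "\<And>i. j < i \<Longrightarrow> v i = 0"
  shows "lexless u (dec j v) \<or> (\<forall>i<j. u i = v i) \<and> u j = dec j v j"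
proof -
  obtain c where c: "u c < v c" "\<forall>i<c. u i = v i" using assms(2) by (auto simp: lexless_def)
  have "c \<le> j" using c assms(3)[of c] by (metis gr_implies_not_zero not_le)
  show ?thesis
  proof (cases "c = j")
    case True
    show ?thesis
    proof (cases "u j < v j - 1")
      case True
      then have "lexless u (dec j v)" unfolding lexless_def dec_apply
        using c \<open>c = j\<close> by (intro exI[of _ j]) auto
      then show ?thesis ..
    qed (use c True in \<open>auto simp: dec_apply\<close>)
  next
    case False
    then have "lexless u (dec j v)" unfolding lexless_def dec_apply
      using c \<open>c \<le> j\<close> by (intro exI[of _ c]) auto
    then show ?thesis ..
  qed
qed

definition top_var :: "(nat \<Rightarrow> nat) \<Rightarrow> nat \<Rightarrow> bool" where
  "top_var u t \<longleftrightarrow> 0 < u t \<and> (\<forall>i>t. u i = 0)"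

lemma top_var_ex:
  assumes "u \<in> mons m (Suc d)" obtains t where "t < m" "top_var u t"
proof -
  have fin: "finite {i. 0 < u i}"
    by (rule finite_subset[of _ "{..<m}"]) (use mons_pos_less[OF assms] in auto)
  have "{i. 0 < u i} \<noteq> {}" using mons_ex_pos[OF assms] by blast
  then have M1: "Max {i. 0 < u i} \<in> {i. 0 < u i}" by (rule Max_in[OF fin])
  have M2: "i \<le> Max {i. 0 < u i}" if "0 < u i" for i using Max_ge[OF fin] that by simp
  have "top_var u (Max {i. 0 < u i})"
    unfolding top_var_def using M1 M2 by (meson leD mem_Collect_eq neq0_conv)
  moreover have "Max {i. 0 < u i} < m" using M1 mons_pos_less[OF assms] by simp
  ultimately show ?thesis using that by blast
qed

text \<open>Of the quotients of \<open>u\<close> by its variables, the one by the last variable is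
  the largest. Membership in the shadow of a segment can therefore be tested on this quotient
  alone.\<close>

lemma lexless_dec_dec:
  assumes "top_var u t" "0 < u i" "i \<noteq> t" shows "lexless (dec i u) (dec t u)"
proof -
  have "i < t" using assms by (metis less_irrefl linorder_neqE_nat top_var_def)
  then show ?thesis using assms(2) unfolding lexless_def
    by (intro exI[of _ i]) (auto simp: dec_apply)
qed

lemma lexseg_dec_top:
  assumes L: "lexseg m d L" and u: "u \<in> shadow m L" and t: "top_var u t"
  shows "dec t u \<in> L"
proof -
  obtain i v where iv: "i < m" "v \<in> L" "u = inc i v" using u by (rule shadowE)
  have "u \<in> mons m (Suc d)" using iv lexseg_mons[OF L] mons_inc by blast
  then have "dec t u \<in> mons m d" using t by (meson mons_dec mons_pos_less top_var_def)
  moreover have "dec t u = v \<or> lexless v (dec t u)"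
    using lexless_dec_dec[OF t, of i] iv by (cases "i = t") (auto simp: inc_apply)
  ultimately show ?thesis using iv L lexsegD by blast
qed

text \<open>With \<open>t\<close> and \<open>s\<close> the last variables of \<open>v\<close> and
  \<open>u\<close>, compare \<open>dec t v\<close> with \<open>dec s u\<close>, which lies in
  \<open>L\<close>. If \<open>u\<close> is not below \<open>dec t v\<close>, the two agree up to
  \<open>t\<close>; then \<open>u\<close> has degree \<open>d\<close> up to \<open>t\<close>, so
  \<open>s\<close> comes later and the quotients coincide.\<close>

lemma shadow_lexseg:
  assumes L: "lexseg m d L" shows "lexseg m (Suc d) (shadow m L)"
  unfolding lexseg_def
proof (intro conjI ballI impI)
  show "shadow m L \<subseteq> mons m (Suc d)" using shadow_mons[OF lexseg_mons[OF L]] .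
next
  fix u v assume u: "u \<in> shadow m L" and v: "v \<in> mons m (Suc d)" and less: "lexless u v"
  have um: "u \<in> mons m (Suc d)" using u shadow_mons[OF lexseg_mons[OF L]] by blast
  obtain t where t: "t < m" "top_var v t" using top_var_ex[OF v] by blast
  obtain s where s: "s < m" "top_var u s" using top_var_ex[OF um] by blast
  have dv: "dec t v \<in> mons m d" using t v by (simp add: mons_dec top_var_def)
  have du: "dec s u \<in> L" using lexseg_dec_top[OF L u s(2)] .
  have "lexless u (dec t v) \<or> (\<forall>i<t. u i = v i) \<and> u t = dec t v t"
    using lexless_dec less t by (simp add: top_var_def)
  then have "dec t v = dec s u \<or> lexless (dec s u) (dec t v)"
  proof
    assume *: "lexless u (dec t v)"
    have "lexless (dec s u) u" unfolding lexless_def using s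
      by (intro exI[of _ s]) (auto simp: dec_apply top_var_def)
    with * show ?thesis using lexless_trans by blast
  next
    assume *: "(\<forall>i<t. u i = v i) \<and> u t = dec t v t"
    then have "deg (Suc t) u = deg (Suc t) (dec t v)"
      by (intro deg_cong) (auto simp: dec_apply less_Suc_eq)
    also have "\<dots> = d"
      using deg_eq_prefix[of "Suc t" m "dec t v"] mons_deg[OF dv] t
      by (simp add: top_var_def dec_apply)
    finally have degu: "deg (Suc t) u = d" .
    have "\<not> s \<le> t"
    proof
      assume "s \<le> t"
      then have "deg m u = deg (Suc t) u" using s t by (intro deg_eq_prefix) (auto simp: top_var_def)
      then show False using degu mons_deg[OF um] by simp
    qed
    have "dec t v i \<le> dec s u i" for i
    proof (cases i t rule: linorder_cases)
      case less
      then show ?thesis using * \<open>\<not> s \<le> t\<close> by (simp add: dec_apply)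
    next
      case equal
      then show ?thesis using * \<open>\<not> s \<le> t\<close> by (simp add: dec_apply)
    next
      case greater
      then show ?thesis using t by (simp add: dec_apply top_var_def)
    qed
    then have "dec t v = dec s u"
      using mons_eqI[OF dv, of "dec s u"] du lexseg_mons[OF L] by blast
    then show ?thesis ..
  qed
  then have "dec t v \<in> L" using du lexsegD[OF L du dv] by metis
  then have "inc t (dec t v) \<in> shadow m L" using t shadowI by blast
  then show "v \<in> shadow m L" using t by (simp add: top_var_def)
qed

text \<open>The quotient of \<open>inc t u\<close> by its last variable is \<open>u\<close>, so
  \<open>inc t u\<close> is outside the shadow. For a larger \<open>v\<close>, the quotient by its
  last variable is above \<open>u\<close> and hence in \<open>L\<close>.\<close>

lemma first_out_shadow:
  assumes u: "first_out m (Suc d) L u" and t: "top_var u t"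
  shows "first_out m (Suc (Suc d)) (shadow m L) (inc t u)" "top_var (inc t u) t"
proof -
  have L: "lexseg m (Suc d) L" using u first_out_lexseg by blast
  have um: "u \<in> mons m (Suc d)" using u by (simp add: first_out_def)
  have tm: "t < m" using t um by (metis mons_pos_less top_var_def)
  show t': "top_var (inc t u) t" using t by (auto simp: top_var_def inc_apply)
  have um': "inc t u \<in> mons m (Suc (Suc d))" using um tm by (simp add: mons_inc)
  have "inc t u \<notin> shadow m L"
    using lexseg_dec_top[OF L _ t'] first_out_notin[OF u] by auto
  then have sub: "shadow m L \<subseteq> {v \<in> mons m (Suc (Suc d)). lexless (inc t u) v}"
    using lexseg_not_in[OF shadow_lexseg[OF L]] um' shadow_mons[OF lexseg_mons[OF L]] by blast
  have "v \<in> shadow m L" if v: "v \<in> mons m (Suc (Suc d))" "lexless (inc t u) v" for v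
  proof -
    obtain s where s: "s < m" "top_var v s" using top_var_ex[OF v(1)] by blast
    have dv: "dec s v \<in> mons m (Suc d)" using s v by (simp add: mons_dec top_var_def)
    have "lexless u (dec s v)"
    proof -
      have "lexless (inc t u) (dec s v) \<or> (\<forall>i<s. inc t u i = v i) \<and> inc t u s = dec s v s"
        using lexless_dec s v by (simp add: top_var_def)
      then show ?thesis
      proof
        assume *: "lexless (inc t u) (dec s v)"
        have "lexless u (inc t u)" unfolding lexless_def
          by (intro exI[of _ t]) (auto simp: inc_apply)
        with * show ?thesis using lexless_trans by blast
      next
        \<comment> \<open>This case is impossible: \<open>u\<close> would have its full degree up to
          \<open>s\<close>, although the later variable \<open>t\<close> divides it.\<close>
        assume *: "(\<forall>i<s. inc t u i = v i) \<and> inc t u s = dec s v s"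
        have "deg (Suc s) (inc t u) = deg (Suc s) (dec s v)"
          using * by (intro deg_cong) (auto simp: dec_apply less_Suc_eq)
        also have "\<dots> = Suc d"
          using deg_eq_prefix[of "Suc s" m "dec s v"] mons_deg[OF dv] s
          by (simp add: top_var_def dec_apply)
        finally have 1: "deg (Suc s) (inc t u) = Suc d" .
        have st: "s < t"
        proof (rule ccontr)
          assume "\<not> s < t"
          then have "deg m (inc t u) = deg (Suc s) (inc t u)"
            using s t by (intro deg_eq_prefix) (auto simp: top_var_def inc_apply)
          then show False using 1 mons_deg[OF um'] by simp
        qed
        then have "deg (Suc s) u = Suc d"
          using 1 deg_cong[of "Suc s" "inc t u" u] by (auto simp: inc_apply)
        moreover have "deg (Suc s) u < deg (Suc t) u"
          using deg_prefix_le[of "Suc s" t u] st t by (auto simp: top_var_def)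
        moreover have "deg (Suc t) u \<le> deg m u" using tm by (intro deg_prefix_le) auto
        ultimately show ?thesis using mons_deg[OF um] by linarith
      qed
    qed
    then have "dec s v \<in> L" using u dv by (simp add: first_out_def)
    then have "inc s (dec s v) \<in> shadow m L" using s shadowI by blast
    then show ?thesis using s by (simp add: top_var_def)
  qed
  with sub um' show "first_out m (Suc (Suc d)) (shadow m L) (inc t u)"
    by (auto simp: first_out_def)
qed

section \<open>Compression in two variables\<close>

definition rest :: "nat \<Rightarrow> nat \<Rightarrow> (nat \<Rightarrow> nat) \<Rightarrow> nat \<Rightarrow> nat" where
  "rest i j u = u(i := 0, j := 0)"

definition fib :: "nat \<Rightarrow> nat \<Rightarrow> (nat \<Rightarrow> nat) set \<Rightarrow> (nat \<Rightarrow> nat) \<Rightarrow> (nat \<Rightarrow> nat) set" where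
  "fib i j A w = {u \<in> A. rest i j u = w}"

text \<open>In a group of fixed degree and fixed \<open>rest\<close>, the exponent of
  \<open>j\<close> determines the monomial. Compression replaces the exponents of \<open>j\<close>
  in each fibre by an initial interval of the same length, trading \<open>j\<close> for
  \<open>i\<close>.\<close>

definition pcomp ::
  "nat \<Rightarrow> nat \<Rightarrow> nat \<Rightarrow> nat \<Rightarrow> (nat \<Rightarrow> nat) set \<Rightarrow> (nat \<Rightarrow> nat) set" where
  "pcomp i j m d A = {u \<in> mons m d. u j < card (fib i j A (rest i j u))}"

lemma restD: "rest i j u = rest i j v \<Longrightarrow> k \<noteq> i \<Longrightarrow> k \<noteq> j \<Longrightarrow> u k = v k"
  by (auto simp: rest_def fun_eq_iff split: if_splits)

lemma rest_inc [simp]: "rest i j (inc i u) = rest i j u" "rest i j (inc j u) = rest i j u"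
  by (auto simp: rest_def inc_def fun_eq_iff)

lemma rest_inc_other: "z \<noteq> i \<Longrightarrow> z \<noteq> j \<Longrightarrow> rest i j (inc z u) = inc z (rest i j u)"
  by (auto simp: rest_def inc_def fun_eq_iff)

lemma deg_rest:
  assumes "i < m" "j < m" "i \<noteq> j"
  shows "deg m u = deg m (rest i j u) + u i + u j"
proof -
  have "deg m u = (\<Sum>k\<in>{..<m} - {i,j}. u k) + u i + u j" for u
    unfolding deg_def using assms sum.remove[of "{..<m}" i u] sum.remove[of "{..<m} - {i}" j u]
    by (simp add: Diff_insert2[of _ i "{j}"])
  note this[of u] this[of "rest i j u"]
  moreover have "(\<Sum>k\<in>{..<m} - {i,j}. rest i j u k) = (\<Sum>k\<in>{..<m} - {i,j}. u k)"
    by (rule sum.cong) (auto simp: rest_def)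
  ultimately show ?thesis using assms(3) by (simp add: rest_def)
qed

lemma card_fib_le:
  assumes "finite A" "finite B" "\<And>w. card (fib i j A w) \<le> card (fib i j B w)"
  shows "card A \<le> card B"
    and "card (fib i j A w) < card (fib i j B w) \<Longrightarrow> card A < card B"
proof -
  let ?T = "rest i j ` (A \<union> B)"
  have T: "finite ?T" using assms by simp
  have A: "card A = (\<Sum>w\<in>?T. card (fib i j A w))"
    using sum.group[OF assms(1) T, of "rest i j" "\<lambda>_. 1::nat"] by (simp add: fib_def image_Un)
  have B: "card B = (\<Sum>w\<in>?T. card (fib i j B w))"
    using sum.group[OF assms(2) T, of "rest i j" "\<lambda>_. 1::nat"] by (simp add: fib_def image_Un)
  show "card A \<le> card B" unfolding A B by (rule sum_mono) (rule assms(3))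
  assume less: "card (fib i j A w) < card (fib i j B w)"
  then have "fib i j B w \<noteq> {}" by auto
  then have "w \<in> ?T" by (auto simp: fib_def)
  then show "card A < card B"
    unfolding A B using less assms(3) T by (intro sum_strict_mono_ex1) auto
qed

locale var_pair =
  fixes i j m :: nat
  assumes ij: "i < m" "j < m" "i \<noteq> j"
begin

abbreviation F where "F \<equiv> fib i j"
abbreviation C where "C \<equiv> pcomp i j m"

lemma finite_F: "A \<subseteq> mons m d \<Longrightarrow> finite (F A w)"
  by (rule finite_subset[of _ "mons m d"]) (auto simp: fib_def)

lemma inj_F:
  assumes "A \<subseteq> mons m d" shows "inj_on (\<lambda>u. u j) (F A w)"
proof (rule inj_onI)
  fix u v assume u: "u \<in> F A w" and v: "v \<in> F A w" and e: "u j = v j"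
  have um: "u \<in> mons m d" "v \<in> mons m d" using u v assms by (auto simp: fib_def)
  have *: "u k = v k" if "k \<noteq> i" for k
    using restD[of i j u v k] u v e that by (cases "k = j") (auto simp: fib_def)
  show "u = v"
  proof (cases "u i \<le> v i")
    case True
    then have "u k \<le> v k" for k using * by (cases "k = i") auto
    then show ?thesis using mons_eqI um by blast
  next
    case False
    then have "v k \<le> u k" for k using *[of k] by (cases "k = i") auto
    then show ?thesis using mons_eqI um by blast
  qed
qed

lemma C_mons: "C d A \<subseteq> mons m d"
  by (auto simp: pcomp_def)

lemma card_F_C:
  assumes A: "A \<subseteq> mons m d" shows "card (F (C d A) w) = card (F A w)"
proof (cases "F A w = {}")
  case True
  have "u \<notin> F (C d A) w" for u
  proof
    assume "u \<in> F (C d A) w"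
    then have "u j < card (F A w)" by (auto simp: fib_def pcomp_def)
    then show False using True by simp
  qed
  then have "F (C d A) w = {}" by blast
  then show ?thesis using True by simp
next
  case False
  then obtain u where u: "u \<in> A" "rest i j u = w" by (auto simp: fib_def)
  have um: "u \<in> mons m d" using u A by auto
  define n where "n = u i + u j"
  have sum_ij: "v i + v j = n" if "v \<in> mons m d" "rest i j v = w" for v
    using deg_rest[OF ij, of u] deg_rest[OF ij, of v] that u mons_deg[OF um] mons_deg[OF that(1)]
    by (simp add: n_def)
  have "(\<lambda>u. u j) ` F A w \<subseteq> {..n}"
    using sum_ij A by (force simp: fib_def)
  then have "card ((\<lambda>u. u j) ` F A w) \<le> card {..n}" by (intro card_mono) auto
  \<comment> \<open>The two exponents add up to \<open>n\<close> throughout the group, so the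
    initial interval of exponents fits into it.\<close>
  then have le: "card (F A w) \<le> Suc n" by (simp add: card_image[OF inj_F[OF A]])
  have "(\<lambda>u. u j) ` F (C d A) w = {..<card (F A w)}"
  proof (intro set_eqI iffI)
    fix b assume "b \<in> {..<card (F A w)}"
    then have b: "b < card (F A w)" by simp
    define v where "v = u(i := n - b, j := b)"
    have rv: "rest i j v = w" using u by (auto simp: v_def rest_def)
    have "deg m v = deg m u"
      using deg_rest[OF ij, of u] deg_rest[OF ij, of v] b le ij u rv by (simp add: v_def n_def)
    then have "v \<in> mons m d"
      using um ij by (simp add: mons_def v_def Nvec_def)
    then have "v \<in> F (C d A) w" using b rv by (simp add: fib_def pcomp_def v_def)
    moreover have "v j = b" by (simp add: v_def)
    ultimately show "b \<in> (\<lambda>u. u j) ` F (C d A) w" by force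
  qed (auto simp: fib_def pcomp_def)
  then show ?thesis using card_image[OF inj_F[OF C_mons], of d A w] by simp
qed

lemma card_C: "A \<subseteq> mons m d \<Longrightarrow> card (C d A) = card A"
  using card_fib_le(1)[of "C d A" A i j] card_fib_le(1)[of A "C d A" i j] card_F_C[of A d]
    finite_subset[OF C_mons finite_mons, of d A] finite_subset[of A "mons m d"]
  by (intro antisym) auto

text \<open>After compression, everything contributing to group \<open>w\<close> of the shadow is an
  initial interval of exponents: that of \<open>w\<close> lengthened by one, and those of the groups
  \<open>dec z w\<close>. Their union is the longest of them. The free bound \<open>M\<close> serves
  both the weak and the strict comparison.\<close>

lemma card_F_shadow_C_le:
  assumes A: "A \<subseteq> mons m d"
    and 1: "F A w \<noteq> {} \<Longrightarrow> Suc (card (F A w)) \<le> M"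
    and 2: "\<And>z. z < m \<Longrightarrow> z \<noteq> i \<Longrightarrow> z \<noteq> j \<Longrightarrow> 0 < w z \<Longrightarrow> card (F A (dec z w)) \<le> M"
  shows "card (F (shadow m (C d A)) w) \<le> M"
proof -
  have "u j < M" if u: "u \<in> F (shadow m (C d A)) w" for u
  proof -
    obtain z v where z: "z < m" "v \<in> C d A" "u = inc z v" and w: "rest i j u = w"
      using u by (auto simp: fib_def elim: shadowE)
    have v: "v j < card (F A (rest i j v))" using z by (simp add: pcomp_def)
    show ?thesis
    proof (cases "z = i \<or> z = j")
      case True
      then have "rest i j v = w" using w z by auto
      then have "Suc (v j) < M" using v 1 card_gt_0_iff[of "F A w"] by fastforce
      then show ?thesis using z by (cases "z = j") (auto simp: inc_apply)
    next
      case False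
      then have "rest i j v = dec z w" "0 < w z"
        using w z False by (auto simp: rest_inc_other inc_apply)
      then show ?thesis using v 2[of z] z False by (auto simp: inc_apply)
    qed
  qed
  then have "(\<lambda>u. u j) ` F (shadow m (C d A)) w \<subseteq> {..<M}" by auto
  then have "card ((\<lambda>u. u j) ` F (shadow m (C d A)) w) \<le> card {..<M}"
    by (intro card_mono) auto
  then show ?thesis by (simp add: card_image[OF inj_F[OF shadow_mons[OF C_mons]]])
qed

lemma exponents_shadow:
  "(\<lambda>u. u j) ` F A w \<union> Suc ` (\<lambda>u. u j) ` F A w \<subseteq> (\<lambda>u. u j) ` F (shadow m A) w"
proof -
  have 1: "inc i u \<in> F (shadow m A) w" "inc j u \<in> F (shadow m A) w" if "u \<in> F A w" for u
    using that ij by (auto simp: fib_def shadowI)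
  have 2: "inc i u j = u j" "inc j u j = Suc (u j)" for u
    using ij by (auto simp: inc_apply)
  show ?thesis unfolding image_image
  proof (intro Un_least image_subsetI)
    fix u assume "u \<in> F A w"
    from 1[OF this] show "u j \<in> (\<lambda>u. u j) ` F (shadow m A) w"
      and "Suc (u j) \<in> (\<lambda>u. u j) ` F (shadow m A) w"
      by (metis (no_types) 2 imageI)+
  qed
qed

lemma card_exponents_shadow:
  assumes A: "A \<subseteq> mons m d"
  shows "card ((\<lambda>u. u j) ` F A w \<union> Suc ` (\<lambda>u. u j) ` F A w) \<le> card (F (shadow m A) w)"
  using card_mono[OF _ exponents_shadow[of A w]] finite_F[OF shadow_mons[OF A]]
    card_image[OF inj_F[OF shadow_mons[OF A]]] by simp

text \<open>Multiplication by \<open>i\<close> keeps the exponents of \<open>j\<close>,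
  multiplication by \<open>j\<close> raises them by one, and the largest exponent plus one is
  new.\<close>

lemma Suc_card_F_le:
  assumes A: "A \<subseteq> mons m d" and ne: "F A w \<noteq> {}"
  shows "Suc (card (F A w)) \<le> card (F (shadow m A) w)"
proof -
  define X where "X = (\<lambda>u. u j) ` F A w"
  have X: "finite X" "X \<noteq> {}" using finite_F[OF A] ne by (auto simp: X_def)
  have "Suc (Max X) \<notin> X" using Max_ge[OF X(1), of "Suc (Max X)"] by (metis not_less_eq_eq order_refl)
  then have "Suc (card X) = card (insert (Suc (Max X)) X)" using X by simp
  also have "\<dots> \<le> card (X \<union> Suc ` X)" using X by (intro card_mono) auto
  also have "\<dots> \<le> card (F (shadow m A) w)"
    unfolding X_def by (rule card_exponents_shadow[OF A])
  finally show ?thesis by (simp add: X_def card_image[OF inj_F[OF A]])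
qed

lemma inc_F_dec:
  assumes "z < m" "z \<noteq> i" "z \<noteq> j" "0 < w z"
  shows "inc z ` F A (dec z w) \<subseteq> F (shadow m A) w"
  using assms by (auto simp: fib_def rest_inc_other shadowI)

lemma card_F_dec_le:
  assumes A: "A \<subseteq> mons m d" and z: "z < m" "z \<noteq> i" "z \<noteq> j" "0 < w z"
  shows "card (F A (dec z w)) \<le> card (F (shadow m A) w)"
proof -
  have "card (F A (dec z w)) = card (inc z ` F A (dec z w))"
    by (rule card_image[symmetric]) (meson inj_inc inj_on_subset subset_UNIV)
  also have "\<dots> \<le> card (F (shadow m A) w)"
    using inc_F_dec[where w = w, OF z] finite_F[OF shadow_mons[OF A]] by (intro card_mono) auto
  finally show ?thesis .
qed

lemma card_F_shadow_C:
  "A \<subseteq> mons m d \<Longrightarrow> card (F (shadow m (C d A)) w) \<le> card (F (shadow m A) w)"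
  by (intro card_F_shadow_C_le Suc_card_F_le card_F_dec_le)

lemma card_shadow_C:
  assumes A: "A \<subseteq> mons m d" shows "card (shadow m (C d A)) \<le> card (shadow m A)"
  by (rule card_fib_le(1)[OF finite_shadow[OF C_mons] finite_shadow[OF A] card_F_shadow_C[OF A]])

text \<open>The last hypothesis excludes that the shadow in the group of \<open>u\<close> consists of the multiples of
  another group by a single third variable; compression would not change its size then.\<close>

lemma card_shadow_C_less:
  assumes A: "A \<subseteq> mons m d"
    and u: "u \<in> A" and v: "v \<in> A" "rest i j v = rest i j u" "Suc (u j) < v j"
    and gap: "\<And>x. x \<in> A \<Longrightarrow> rest i j x = rest i j u \<Longrightarrow> x j \<noteq> Suc (u j)"
    and out: "\<And>z. z \<noteq> i \<Longrightarrow> z \<noteq> j \<Longrightarrow> 0 < u z \<Longrightarrow> dec z (inc j u) \<notin> A"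
  shows "card (shadow m (C d A)) < card (shadow m A)"
proof -
  define w where "w = rest i j u"
  define X where "X = (\<lambda>u. u j) ` F A w"
  have X: "finite X" "u j \<in> X" "v j \<in> X"
    using finite_F[OF A, of w] u v(1,2) by (auto simp: X_def fib_def w_def)
  have maxX: "Max X \<in> X" using X by (intro Max_in) auto
  have gap': "Suc (u j) \<notin> X" using gap by (force simp: X_def fib_def w_def)
  have "Suc (Max X) \<notin> X" using Max_ge[OF X(1), of "Suc (Max X)"] by (metis not_less_eq_eq order_refl)
  \<comment> \<open>The gap above \<open>u j\<close> and the end of the fibre yield two different
    new exponents, one more than the compressed fibre gains.\<close>
  moreover have "Max X \<noteq> u j" using v(3) Max_ge[OF X(1,3)] by linarith
  ultimately have "card (insert (Suc (Max X)) (insert (Suc (u j)) X)) = Suc (Suc (card X))"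
    using X gap' by simp
  moreover have "card (insert (Suc (Max X)) (insert (Suc (u j)) X)) \<le> card (X \<union> Suc ` X)"
    using X maxX by (intro card_mono) auto
  moreover have "card (X \<union> Suc ` X) \<le> card (F (shadow m A) w)"
    unfolding X_def by (rule card_exponents_shadow[OF A])
  moreover have "card X = card (F A w)" by (simp add: X_def card_image[OF inj_F[OF A]])
  ultimately have 1: "Suc (Suc (card (F A w))) \<le> card (F (shadow m A) w)" by linarith
  have 2: "card (F A (dec z w)) < card (F (shadow m A) w)"
    if z: "z < m" "z \<noteq> i" "z \<noteq> j" "0 < w z" for z
  proof -
    \<comment> \<open>By \<open>out\<close> this element of the shadow does not come from the group
      \<open>dec z w\<close>, so that group is strictly smaller than the fibre of the
      shadow.\<close>
    have "inc j u \<in> F (shadow m A) w"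
      using u ij by (auto simp: fib_def w_def shadowI)
    moreover have "inc j u \<notin> inc z ` F A (dec z w)"
    proof
      assume "inc j u \<in> inc z ` F A (dec z w)"
      then have "dec z (inc j u) \<in> A" by (auto simp: fib_def)
      moreover have "0 < u z" using z by (simp add: w_def rest_def)
      ultimately show False using out z by blast
    qed
    ultimately have "inc z ` F A (dec z w) \<subset> F (shadow m A) w" using inc_F_dec[where w = w, OF z] by blast
    then have "card (inc z ` F A (dec z w)) < card (F (shadow m A) w)"
      using finite_F[OF shadow_mons[OF A]] by (rule psubset_card_mono[rotated])
    then show ?thesis using card_image[of "inc z"] inj_inc by (metis inj_on_subset subset_UNIV)
  qed
  have "card (F (shadow m (C d A)) w) \<le> card (F (shadow m A) w) - 1"
    by (rule card_F_shadow_C_le[OF A]) (use 1 2 in \<open>force+\<close>)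
  then have "card (F (shadow m (C d A)) w) < card (F (shadow m A) w)" using 1 by linarith
  then show ?thesis
    using card_fib_le(2)[OF finite_shadow[OF C_mons] finite_shadow[OF A] card_F_shadow_C[OF A]]
    by blast
qed

end

section \<open>Strongly stable sets\<close>

definition borel_fixed :: "nat \<Rightarrow> (nat \<Rightarrow> nat) set \<Rightarrow> bool" where
  "borel_fixed m A \<longleftrightarrow> (\<forall>u\<in>A. \<forall>i j. i < j \<longrightarrow> j < m \<longrightarrow> 0 < u j \<longrightarrow> inc i (dec j u) \<in> A)"

lemma borel_fixedD:
  "borel_fixed m A \<Longrightarrow> u \<in> A \<Longrightarrow> i < j \<Longrightarrow> j < m \<Longrightarrow> 0 < u j \<Longrightarrow> inc i (dec j u) \<in> A"
  by (simp add: borel_fixed_def)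

text \<open>Turns the total weight into a strict measure of progress: compression lowers the
  exponent sum of every fibre that is not yet an initial interval.\<close>

lemma sum_lessThan_card_less:
  fixes X :: "nat set"
  assumes "finite X" "X \<noteq> {..<card X}"
  shows "\<Sum>{..<card X} < \<Sum>X"
  using assms
proof (induction "card X" arbitrary: X)
  case 0
  then show ?case by simp
next
  case (Suc n)
  have ne: "X \<noteq> {}" using Suc.hyps(2) by auto
  define a where "a = Max X"
  have a: "a \<in> X" using Suc.prems(1) ne by (simp add: a_def)
  have n: "card (X - {a}) = n" using a Suc.hyps(2) by simp
  have sub: "X \<subseteq> {..a}" using Suc.prems(1) by (auto simp: a_def)
  then have na: "n \<le> a" using card_mono[of "{..a}" X] Suc.hyps(2) by simp
  have eq: "\<Sum>X = a + \<Sum>(X - {a})" using a Suc.prems(1) by (simp add: sum.remove)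
  have eq': "\<Sum>{..<card X} = n + \<Sum>{..<n}" using Suc.hyps(2)[symmetric] by simp
  show ?case
  proof (cases "X - {a} = {..<n}")
    case True
    have "a \<noteq> n"
    proof
      assume "a = n"
      then have "X = {..<Suc n}" using True insert_Diff[OF a] by (simp add: lessThan_Suc)
      then show False using Suc.prems(2) Suc.hyps(2) by simp
    qed
    then show ?thesis using na eq eq' True by simp
  next
    case False
    then have "\<Sum>{..<n} < \<Sum>(X - {a})" using Suc.hyps(1)[of "X - {a}"] Suc.prems(1) n by simp
    then show ?thesis using na eq eq' by linarith
  qed
qed

definition weight :: "nat \<Rightarrow> (nat \<Rightarrow> nat) \<Rightarrow> nat" where
  "weight m u = (\<Sum>k<m. k * u k)"

context var_pair
begin

text \<open>Only the last term varies within a group, with positive slope \<open>j - i\<close>;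
  weights of equally large fibres compare like their exponent sums.\<close>

lemma weight_rest:
  assumes "i < j" "u \<in> mons m d"
  shows "weight m u = weight m (rest i j u) + i * (d - deg m (rest i j u)) + (j - i) * u j"
proof -
  have "weight m u = (\<Sum>k\<in>{..<m} - {i,j}. k * u k) + i * u i + j * u j" for u
    unfolding weight_def using ij sum.remove[of "{..<m}" i "\<lambda>k. k * u k"]
      sum.remove[of "{..<m} - {i}" j "\<lambda>k. k * u k"]
    by (simp add: Diff_insert2[of _ i "{j}"])
  note this[of u] this[of "rest i j u"]
  moreover have "(\<Sum>k\<in>{..<m} - {i,j}. k * rest i j u k) = (\<Sum>k\<in>{..<m} - {i,j}. k * u k)"
    by (rule sum.cong) (auto simp: rest_def)
  moreover have "d - deg m (rest i j u) = u i + u j"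
    using deg_rest[OF ij, of u] mons_deg[OF assms(2)] by simp
  moreover have "i * u j + (j - i) * u j = j * u j"
    using assms(1) by (simp add: add_mult_distrib[symmetric])
  ultimately show ?thesis using ij by (simp add: rest_def add_mult_distrib2)
qed

text \<open>If the exchange of \<open>j\<close> for \<open>i\<close> leaves \<open>A\<close>, the
  fibre of \<open>u\<close> contains the exponent \<open>u j\<close> but not \<open>u j - 1\<close>,
  so it is not an initial interval. Its weight drops, and no other fibre gains weight.\<close>

lemma sum_weight_C_less:
  assumes A: "A \<subseteq> mons m d" and "i < j"
    and u: "u \<in> A" "0 < u j" "inc i (dec j u) \<notin> A"
  shows "sum (weight m) (C d A) < sum (weight m) A"
proof -
  define e where "e w = weight m w + i * (d - deg m w)" for w
  have fibsum: "sum (weight m) (F B w) = card (F B w) * e w + (j - i) * \<Sum>((\<lambda>u. u j) ` F B w)"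
    if B: "B \<subseteq> mons m d" for B w
  proof -
    have "sum (weight m) (F B w) = (\<Sum>u\<in>F B w. e w + (j - i) * u j)"
      using weight_rest[OF \<open>i < j\<close>, of _ d] B
      by (intro sum.cong) (auto simp: fib_def e_def)
    also have "\<dots> = card (F B w) * e w + (j - i) * (\<Sum>u\<in>F B w. u j)"
      by (simp add: sum.distrib sum_distrib_left)
    finally show ?thesis using sum.reindex[OF inj_F[OF B], of "\<lambda>x. x"] by simp
  qed
  have img: "(\<lambda>u. u j) ` F (C d A) w = {..<card (F A w)}" for w
  proof (rule card_subset_eq)
    show "(\<lambda>u. u j) ` F (C d A) w \<subseteq> {..<card (F A w)}" by (auto simp: fib_def pcomp_def)
    show "card ((\<lambda>u. u j) ` F (C d A) w) = card {..<card (F A w)}"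
      using card_F_C[OF A] card_image[OF inj_F[OF C_mons], of d A w] by simp
  qed simp
  have cX: "card ((\<lambda>u. u j) ` F A w) = card (F A w)" for w
    by (rule card_image[OF inj_F[OF A]])
  have finX: "finite ((\<lambda>u. u j) ` F A w)" for w using finite_F[OF A] by simp
  have less: "sum (weight m) (F (C d A) w) < sum (weight m) (F A w)"
    if "(\<lambda>u. u j) ` F A w \<noteq> {..<card (F A w)}" for w
    using sum_lessThan_card_less[OF finX, of w] that \<open>i < j\<close>
    by (simp add: fibsum[OF A] fibsum[OF C_mons] img card_F_C[OF A] cX)
  have le: "sum (weight m) (F (C d A) w) \<le> sum (weight m) (F A w)" for w
  proof (cases "(\<lambda>u. u j) ` F A w = {..<card (F A w)}")
    case True
    then show ?thesis by (simp add: fibsum[OF A] fibsum[OF C_mons] img card_F_C[OF A])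
  qed (use less[of w] in simp)
  let ?T = "rest i j ` mons m d"
  have tot: "sum (weight m) B = (\<Sum>w\<in>?T. sum (weight m) (F B w))" if "B \<subseteq> mons m d" for B
    using sum.group[of B ?T "rest i j" "weight m"] that finite_subset[OF that]
    by (simp add: fib_def image_mono)
  define w where "w = rest i j u"
  have "u j \<in> (\<lambda>u. u j) ` F A w" using u by (auto simp: fib_def w_def)
  moreover have "u j - 1 \<notin> (\<lambda>u. u j) ` F A w"
  proof
    assume "u j - 1 \<in> (\<lambda>u. u j) ` F A w"
    then obtain v where v: "v \<in> A" "rest i j v = w" "v j = u j - 1" by (auto simp: fib_def)
    have vm: "v \<in> mons m d" and um: "u \<in> mons m d" using v u A by auto
    have "v i = Suc (u i)"
      using deg_rest[OF ij, of u] deg_rest[OF ij, of v] v u mons_deg[OF vm] mons_deg[OF um]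
      by (simp add: w_def)
    then have "v = inc i (dec j u)"
    proof (intro ext)
      fix k
      show "v k = inc i (dec j u) k"
        using \<open>v i = Suc (u i)\<close> v(3) restD[of i j v u k] v(2) ij
        by (cases "k = i"; cases "k = j") (auto simp: inc_apply dec_apply w_def)
    qed
    then show False using v u by simp
  qed
  ultimately have "(\<lambda>u. u j) ` F A w \<noteq> {..<card (F A w)}"
    by (metis lessThan_iff less_imp_diff_less)
  from less[OF this] have "\<exists>w\<in>?T. sum (weight m) (F (C d A) w) < sum (weight m) (F A w)"
    using u A by (auto simp: w_def)
  then show ?thesis
    unfolding tot[OF A] tot[OF C_mons] using le by (intro sum_strict_mono_ex1) auto
qed

end

text \<open>Take a set of least total weight among those of the same size with no larger shadow. A
  failing exchange would allow a compression to smaller weight.\<close>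

lemma borel_fixed_exists:
  assumes A: "A \<subseteq> mons m d"
  shows "\<exists>B. B \<subseteq> mons m d \<and> card B = card A \<and> card (shadow m B) \<le> card (shadow m A) \<and> borel_fixed m B"
proof -
  let ?P = "\<lambda>B. B \<subseteq> mons m d \<and> card B = card A \<and> card (shadow m B) \<le> card (shadow m A)"
  obtain B where B: "?P B" and least: "\<And>B'. ?P B' \<Longrightarrow> sum (weight m) B \<le> sum (weight m) B'"
    using ex_has_least_nat[of ?P A "sum (weight m)"] A by blast
  have "borel_fixed m B"
    unfolding borel_fixed_def
  proof (intro ballI allI impI, rule ccontr)
    fix u i j assume u: "u \<in> B" "i < j" "j < m" "0 < u j" "inc i (dec j u) \<notin> B"
    then interpret var_pair i j m by unfold_locales auto
    have "?P (C d B)" using B card_C[of B d] card_shadow_C[of B d] C_mons[of d B] by auto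
    from least[OF this] show False using sum_weight_C_less[of B d u] B u by simp
  qed
  then show ?thesis using B by blast
qed

section \<open>Slicing by the last variable\<close>

text \<open>A slice is stored as a set in the first \<open>m\<close> variables, so that induction on
  the number of variables applies to it.\<close>

definition lev :: "nat \<Rightarrow> (nat \<Rightarrow> nat) set \<Rightarrow> nat \<Rightarrow> (nat \<Rightarrow> nat) set" where
  "lev m A k = {v \<in> Nvec m. v(m := k) \<in> A}"

lemma Nvec_upd_zero [simp]: "v \<in> Nvec m \<Longrightarrow> v(m := 0) = v"
  by (simp add: Nvec_def fun_upd_idem)

lemma upd_mons_iff: "v \<in> Nvec m \<Longrightarrow> v(m := k) \<in> mons (Suc m) d \<longleftrightarrow> k \<le> d \<and> v \<in> mons m (d - k)"
  by (auto simp: mons_def Nvec_def)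

lemma lev_mons: "A \<subseteq> mons (Suc m) d \<Longrightarrow> lev m A k \<subseteq> mons m (d - k)"
  using upd_mons_iff by (auto simp: lev_def)

lemma lev_empty: "A \<subseteq> mons (Suc m) d \<Longrightarrow> d < k \<Longrightarrow> lev m A k = {}"
  using upd_mons_iff[of _ m k d] by (auto simp: lev_def dest: subsetD)

lemma finite_lev: "A \<subseteq> mons (Suc m) d \<Longrightarrow> finite (lev m A k)"
  by (meson finite_mons finite_subset lev_mons)

lemma inj_on_upd: "inj_on (\<lambda>v. v(m := k)) (Nvec m)"
  by (rule inj_onI) (metis Nvec_upd_zero fun_upd_upd)

lemma upd_last_mem_lev: "u \<in> A \<Longrightarrow> u \<in> Nvec (Suc m) \<Longrightarrow> u(m := 0) \<in> lev m A (u m)"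
  by (auto simp: lev_def Nvec_def)

lemma card_eq_sum_lev:
  assumes A: "A \<subseteq> mons (Suc m) d"
  shows "card A = (\<Sum>k\<le>d. card (lev m A k))"
proof -
  have fin: "finite A" using A finite_subset by blast
  have img: "(\<lambda>u. u m) ` A \<subseteq> {..d}" using A by (auto simp: mons_def)
  have "card {u \<in> A. u m = k} = card (lev m A k)" for k
  proof -
    have "{u \<in> A. u m = k} = (\<lambda>v. v(m := k)) ` lev m A k"
    proof (intro set_eqI iffI)
      fix u assume "u \<in> {u \<in> A. u m = k}"
      moreover from this have "u \<in> Nvec (Suc m)" using A by (auto simp: mons_def)
      ultimately have "u(m := 0) \<in> lev m A k" "u = (u(m := 0))(m := k)"
        using upd_last_mem_lev by auto
      then show "u \<in> (\<lambda>v. v(m := k)) ` lev m A k" by blast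
    qed (auto simp: lev_def)
    moreover have "inj_on (\<lambda>v. v(m := k)) (lev m A k)"
      by (rule inj_on_subset[OF inj_on_upd]) (auto simp: lev_def)
    ultimately show ?thesis by (simp add: card_image)
  qed
  then show ?thesis
    using sum.group[OF fin _ img, of "\<lambda>_. 1::nat"] by simp
qed

lemma lev_shadow_0:
  assumes "A \<subseteq> mons (Suc m) d"
  shows "lev m (shadow (Suc m) A) 0 = shadow m (lev m A 0)"
proof (intro set_eqI iffI)
  fix v assume "v \<in> lev m (shadow (Suc m) A) 0"
  then have v: "v \<in> Nvec m" "v(m := 0) \<in> shadow (Suc m) A" by (auto simp: lev_def)
  then obtain i u where i: "i < Suc m" "u \<in> A" "v(m := 0) = inc i u" by (auto elim: shadowE)
  have "i \<noteq> m" using i(3) by (auto simp: inc_def fun_eq_iff split: if_splits)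
  then have "i < m" "u m = 0" using i by (auto simp: inc_def fun_eq_iff split: if_splits)
  moreover have "v = inc i u" using i v(1) by simp
  moreover have "u(m := 0) \<in> lev m A (u m)" using i assms by (intro upd_last_mem_lev) (auto simp: mons_def)
  moreover have "u(m := 0) = u" using \<open>u m = 0\<close> by (simp add: fun_upd_idem)
  ultimately show "v \<in> shadow m (lev m A 0)" by (simp add: shadowI)
next
  fix v assume "v \<in> shadow m (lev m A 0)"
  then obtain i u where i: "i < m" "u \<in> lev m A 0" "v = inc i u" by (auto elim: shadowE)
  then have "v(m := 0) = inc i (u(m := 0))" by (auto simp: inc_def)
  moreover have "inc i (u(m := 0)) \<in> shadow (Suc m) A" using i by (auto simp: lev_def intro: shadowI)
  ultimately show "v \<in> lev m (shadow (Suc m) A) 0"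
    using i by (auto simp: lev_def inc_in_Nvec)
qed

lemma lev_shadow_Suc:
  assumes "A \<subseteq> mons (Suc m) d"
  shows "lev m (shadow (Suc m) A) (Suc k) = shadow m (lev m A (Suc k)) \<union> lev m A k"
proof (intro set_eqI iffI)
  fix v assume "v \<in> lev m (shadow (Suc m) A) (Suc k)"
  then have v: "v \<in> Nvec m" "v(m := Suc k) \<in> shadow (Suc m) A" by (auto simp: lev_def)
  then obtain i u where i: "i < Suc m" "u \<in> A" "v(m := Suc k) = inc i u" by (auto elim: shadowE)
  have mem: "u(m := 0) \<in> lev m A (u m)" using i assms by (intro upd_last_mem_lev) (auto simp: mons_def)
  have v': "v = (inc i u)(m := 0)" using i(3) v(1) Nvec_upd_zero by (metis fun_upd_upd)
  show "v \<in> shadow m (lev m A (Suc k)) \<union> lev m A k"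
  proof (cases "i = m")
    case True
    then have "u m = k" "v = u(m := 0)"
      using fun_cong[OF i(3), of m] v' by (auto simp: inc_def)
    then show ?thesis using mem by simp
  next
    case False
    then have "u m = Suc k" using i(3) by (auto simp: inc_def fun_eq_iff split: if_splits)
    moreover have "v = inc i (u(m := 0))" using v' False by (auto simp: inc_def)
    ultimately show ?thesis using mem i False by (auto simp: shadow_def)
  qed
next
  fix v assume "v \<in> shadow m (lev m A (Suc k)) \<union> lev m A k"
  then show "v \<in> lev m (shadow (Suc m) A) (Suc k)"
  proof
    assume "v \<in> shadow m (lev m A (Suc k))"
    then obtain i u where i: "i < m" "u \<in> lev m A (Suc k)" "v = inc i u" by (auto elim: shadowE)
    then have "v(m := Suc k) = inc i (u(m := Suc k))" by (auto simp: inc_def)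
    moreover have "inc i (u(m := Suc k)) \<in> shadow (Suc m) A"
      using i by (auto simp: lev_def intro: shadowI)
    ultimately show ?thesis using i by (auto simp: lev_def inc_in_Nvec)
  next
    assume v: "v \<in> lev m A k"
    then have "inc m (v(m := k)) \<in> shadow (Suc m) A" by (auto simp: lev_def intro: shadowI)
    then show ?thesis using v by (simp add: lev_def inc_def)
  qed
qed

lemma card_shadow_eq_sum_lev:
  assumes A: "A \<subseteq> mons (Suc m) d"
  shows "card (shadow (Suc m) A) =
    card (shadow m (lev m A 0)) + (\<Sum>k\<le>d. card (shadow m (lev m A (Suc k)) \<union> lev m A k))"
  using card_eq_sum_lev[OF shadow_mons[OF A]]
  by (simp add: sum.atMost_Suc_shift lev_shadow_0[OF A] lev_shadow_Suc[OF A] del: sum.atMost_Suc)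

text \<open>Exchanging the last variable for an earlier one puts the shadow of each slice into the
  preceding slice, so slice \<open>k + 1\<close> of the shadow is slice \<open>k\<close> of
  \<open>A\<close>. For sets of equal size only slice 0 remains to be compared.\<close>

lemma card_shadow_borel_fixed:
  assumes A: "A \<subseteq> mons (Suc m) d" and b: "borel_fixed (Suc m) A"
  shows "card (shadow (Suc m) A) = card (shadow m (lev m A 0)) + card A"
proof -
  have "shadow m (lev m A (Suc k)) \<subseteq> lev m A k" for k
  proof
    fix v assume "v \<in> shadow m (lev m A (Suc k))"
    then obtain i u where i: "i < m" "u \<in> lev m A (Suc k)" "v = inc i u" by (auto elim: shadowE)
    then have "inc i (dec m (u(m := Suc k))) \<in> A"
      by (intro borel_fixedD[OF b]) (auto simp: lev_def)
    moreover have "inc i (dec m (u(m := Suc k))) = v(m := k)" using i by (auto simp: inc_def dec_def)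
    ultimately show "v \<in> lev m A k" using i by (auto simp: lev_def inc_in_Nvec)
  qed
  then have "shadow m (lev m A (Suc k)) \<union> lev m A k = lev m A k" for k by blast
  then show ?thesis using card_shadow_eq_sum_lev[OF A] card_eq_sum_lev[OF A] by simp
qed

lemma lexless_upd:
  assumes "v \<in> Nvec m" "w \<in> Nvec m" "lexless v w"
  shows "lexless (v(m := k)) (w(m := k))"
proof -
  obtain c where c: "v c < w c" "\<forall>i<c. v i = w i" using assms(3) by (auto simp: lexless_def)
  have "c < m" using c(1) assms(2) by (cases "c < m") (simp_all add: Nvec_def)
  then show ?thesis using c unfolding lexless_def by (intro exI[of _ c]) auto
qed

lemma lexseg_lev:
  assumes "lexseg (Suc m) d L" "k \<le> d" shows "lexseg m (d - k) (lev m L k)"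
  unfolding lexseg_def
proof (intro conjI ballI impI)
  show "lev m L k \<subseteq> mons m (d - k)" using lev_mons[OF lexseg_mons[OF assms(1)]] .
  fix u v assume u: "u \<in> lev m L k" and v: "v \<in> mons m (d - k)" and "lexless u v"
  then have "lexless (u(m := k)) (v(m := k))" by (intro lexless_upd) (auto simp: lev_def mons_def)
  moreover have "v(m := k) \<in> mons (Suc m) d" using v assms(2) upd_mons_iff[of v m k d] by (simp add: mons_def)
  ultimately show "v \<in> lev m L k"
    using lexsegD[OF assms(1), of "u(m := k)"] u v by (auto simp: lev_def mons_def)
qed

lemma lexseg_borel_fixed:
  assumes "lexseg m d L" shows "borel_fixed m L"
  unfolding borel_fixed_def
proof (intro ballI allI impI)
  fix u i j assume u: "u \<in> L" "i < j" "j < m" "0 < u j"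
  have um: "u \<in> mons m d" using u lexseg_mons[OF assms] by blast
  then have "0 < d" using u le_deg[of j m u] mons_deg[OF um] by simp
  then obtain e where e: "d = Suc e" by (cases d) auto
  have "inc i (dec j u) \<in> mons m d" using um u unfolding e by (intro mons_inc mons_dec) auto
  moreover have "lexless u (inc i (dec j u))" unfolding lexless_def
    using u by (intro exI[of _ i]) (auto simp: inc_apply dec_apply)
  ultimately show "inc i (dec j u) \<in> L" using lexsegD[OF assms] u by blast
qed

section \<open>Division by the last variable and Macaulay's inequality for shadows\<close>

definition quo :: "nat \<Rightarrow> (nat \<Rightarrow> nat) set \<Rightarrow> (nat \<Rightarrow> nat) set" where
  "quo m A = {u \<in> Nvec (Suc m). inc m u \<in> A}"

lemma quo_mons: "A \<subseteq> mons (Suc m) (Suc d) \<Longrightarrow> quo m A \<subseteq> mons (Suc m) d"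
  using mons_incD[of m _ "Suc m" d] by (auto simp: quo_def)

lemma lev_quo: "lev m (quo m A) k = lev m A (Suc k)"
  by (auto simp: lev_def quo_def Nvec_def inc_def)

lemma card_quo:
  assumes "A \<subseteq> mons (Suc m) (Suc d)" shows "card A = card (lev m A 0) + card (quo m A)"
  using card_eq_sum_lev[OF assms] card_eq_sum_lev[OF quo_mons[OF assms]]
  by (simp add: sum.atMost_Suc_shift lev_quo del: sum.atMost_Suc)

lemma lexseg_quo:
  assumes "lexseg (Suc m) (Suc d) L" shows "lexseg (Suc m) d (quo m L)"
  unfolding lexseg_def
proof (intro conjI ballI impI)
  show "quo m L \<subseteq> mons (Suc m) d" using quo_mons[OF lexseg_mons[OF assms]] .
  fix u v assume "u \<in> quo m L" "v \<in> mons (Suc m) d" "lexless u v"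
  then show "v \<in> quo m L"
    using lexsegD[OF assms, of "inc m u" "inc m v"] lexless_inc[of u v m] mons_inc[of v "Suc m" d m]
    by (auto simp: quo_def mons_def)
qed

lemma borel_fixed_quo:
  assumes "borel_fixed (Suc m) A" shows "borel_fixed (Suc m) (quo m A)"
  unfolding borel_fixed_def
proof (intro ballI allI impI)
  fix u i j assume u: "u \<in> quo m A" "i < j" "j < Suc m" "0 < u j"
  then have "inc i (dec j (inc m u)) \<in> A"
    by (intro borel_fixedD[OF assms]) (auto simp: quo_def inc_apply)
  moreover have "inc i (dec j (inc m u)) = inc m (inc i (dec j u))"
    using u by (auto simp: inc_def dec_def fun_eq_iff)
  ultimately show "inc i (dec j u) \<in> quo m A"
    using u by (simp add: quo_def inc_in_Nvec dec_in_Nvec)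
qed

text \<open>Divide \<open>v\<close> by its last variable. If the quotient were neither
  \<open>u\<close> nor in \<open>quo m L\<close>, it would be below \<open>u\<close>, with the first
  difference before that variable for degree reasons. Then \<open>v\<close> is below
  \<open>inc m u\<close>, which forces \<open>u\<close> into \<open>quo m L\<close>.\<close>

lemma lev_0_subset_shadow:
  assumes L: "lexseg (Suc m) (Suc d) L" and u: "first_out (Suc m) d (quo m L) u"
  shows "lev m L 0 \<subseteq> shadow m (lev m (insert u (quo m L)) 0)"
proof
  fix v assume "v \<in> lev m L 0"
  then have vN: "v \<in> Nvec m" and "v(m := 0) \<in> L" by (auto simp: lev_def)
  moreover from vN have "v(m := 0) = v" by (auto simp: Nvec_def)
  ultimately have vL: "v \<in> L" by simp
  have um: "u \<in> mons (Suc m) d" using u by (simp add: first_out_def)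
  have vm: "v \<in> mons (Suc m) (Suc d)" using vL lexseg_mons[OF L] by blast
  obtain i where i: "top_var v i" using top_var_ex[OF vm] by blast
  then have im: "i < m" using vN by (cases "i < m") (simp_all add: Nvec_def top_var_def)
  define v' where "v' = dec i v"
  have v'm: "v' \<in> mons (Suc m) d" using i im vm by (simp add: v'_def mons_dec top_var_def)
  have v'N: "v' \<in> Nvec m" using vN by (simp add: v'_def dec_in_Nvec)
  have "v' \<in> insert u (quo m L)"
  proof (rule ccontr)
    assume "v' \<notin> insert u (quo m L)"
    then have "lexless v' u" using u v'm lexless_linear[of v' u] by (auto simp: first_out_def)
    then obtain c where c: "v' c < u c" "\<forall>k<c. v' k = u k" by (auto simp: lexless_def)
    have cm: "c < Suc m" using c um by (metis gr_implies_not_zero mons_zero_outside not_le)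
    have "c < i"
    proof (rule ccontr)
      assume "\<not> c < i"
      then have "deg (Suc m) v' = deg (Suc c) v'"
        using i cm by (intro deg_eq_prefix) (auto simp: v'_def top_var_def dec_apply)
      also have "\<dots> < deg (Suc c) u" using c deg_cong[of c v' u] by simp
      also have "\<dots> \<le> deg (Suc m) u" using cm by (intro deg_prefix_le) auto
      finally show False using mons_deg[OF v'm] mons_deg[OF um] by simp
    qed
    then have "lexless v (inc m u)" unfolding lexless_def
      using c im by (intro exI[of _ c]) (auto simp: v'_def inc_apply dec_apply)
    then have "inc m u \<in> L" using lexsegD[OF L vL] um by (simp add: mons_inc)
    then have "u \<in> quo m L" using um by (simp add: quo_def mons_def)
    then show False using first_out_notin[OF u] by simp
  qed
  moreover have "v'(m := 0) = v'" using v'N by (auto simp: Nvec_def)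
  ultimately have "v' \<in> lev m (insert u (quo m L)) 0" using v'N by (simp add: lev_def)
  then have "inc i v' \<in> shadow m (lev m (insert u (quo m L)) 0)" using im by (rule shadowI)
  then show "v \<in> shadow m (lev m (insert u (quo m L)) 0)"
    using i by (simp add: v'_def top_var_def)
qed

text \<open>The role of Green's restriction theorem in the usual proof of Macaulay's theorem.\<close>

lemma card_lev_0_le:
  assumes IH: "\<And>e L A. lexseg m e L \<Longrightarrow> A \<subseteq> mons m e \<Longrightarrow> card L \<le> card A \<Longrightarrow>
      card (shadow m L) \<le> card (shadow m A)"
    and "A \<subseteq> mons (Suc m) d" "borel_fixed (Suc m) A" "lexseg (Suc m) d L" "card L \<le> card A"
  shows "card (lev m L 0) \<le> card (lev m A 0)"
  using assms(2-)
proof (induction d arbitrary: A L)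
  case 0
  then show ?case
    using card_eq_sum_lev[of A m 0] card_eq_sum_lev[OF lexseg_mons, of m 0 L] by simp
next
  case (Suc d)
  note A = Suc.prems(1) and b = Suc.prems(2) and L = Suc.prems(3)
  show ?case
  proof (rule ccontr)
    assume "\<not> ?case"
    \<comment> \<open>If slice 0 of \<open>L\<close> is too large, the rest of \<open>L\<close> is
      too small: \<open>quo m L\<close> with one more monomial is still no larger than
      \<open>quo m A\<close>, and the induction on the degree applies.\<close>
    then have less: "card (quo m L) < card (quo m A)"
      using card_quo[OF A] card_quo[OF lexseg_mons[OF L]] Suc.prems(4) by linarith
    then have "quo m L \<noteq> mons (Suc m) d"
      using card_mono[OF finite_mons quo_mons[OF A]] by auto
    then obtain u where u: "first_out (Suc m) d (quo m L) u"
      using first_out_ex[OF lexseg_quo[OF L]] by blast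
    define K where "K = insert u (quo m L)"
    have K: "lexseg (Suc m) d K" unfolding K_def by (rule first_out_insert[OF u])
    have "card K = Suc (card (quo m L))"
      unfolding K_def using lexseg_finite[OF lexseg_quo[OF L]] first_out_notin[OF u] by simp
    then have "card (lev m K 0) \<le> card (lev m (quo m A) 0)"
      using less by (intro Suc.IH quo_mons[OF A] borel_fixed_quo[OF b] K) auto
    then have "card (shadow m (lev m K 0)) \<le> card (shadow m (lev m (quo m A) 0))"
      using lexseg_lev[OF K, of 0] lev_mons[OF quo_mons[OF A], of 0] by (intro IH) auto
    moreover have "card (lev m L 0) \<le> card (shadow m (lev m K 0))"
      using lev_0_subset_shadow[OF L u] finite_shadow[OF lev_mons[OF lexseg_mons[OF K]]]
      unfolding K_def by (intro card_mono) auto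
    \<comment> \<open>Closes the chain: slice 0 of \<open>L\<close> is at most the shadow of slice 0
      of \<open>K\<close>, hence at most the shadow of slice 1 of \<open>A\<close>, which strong
      stability places in slice 0 of \<open>A\<close>.\<close>
    moreover have "shadow m (lev m (quo m A) 0) \<subseteq> lev m A 0"
    proof
      fix v assume "v \<in> shadow m (lev m (quo m A) 0)"
      then obtain i x where i: "i < m" "x \<in> lev m A 1" "v = inc i x"
        by (auto simp: lev_quo elim: shadowE)
      then have "inc i (dec m (x(m := 1))) \<in> A"
        by (intro borel_fixedD[OF b]) (auto simp: lev_def)
      moreover have "inc i (dec m (x(m := 1))) = v(m := 0)" using i by (auto simp: inc_def dec_def)
      ultimately show "v \<in> lev m A 0" using i by (auto simp: lev_def inc_in_Nvec)
    qed
    then have "card (shadow m (lev m (quo m A) 0)) \<le> card (lev m A 0)"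
      using finite_lev[OF A] by (rule card_mono[rotated])
    ultimately show False using \<open>\<not> ?case\<close> by linarith
  qed
qed

text \<open>Macaulay's theorem for shadows. After passing to a strongly stable set, the shadow is
  governed by slice 0, which for the segment is smallest and again a segment. The induction compares
  slices of unequal size, hence the inequality between the sizes.\<close>

theorem card_shadow_lexseg_le:
  assumes "lexseg m d L" "A \<subseteq> mons m d" "card L \<le> card A"
  shows "card (shadow m L) \<le> card (shadow m A)"
  using assms
proof (induction m arbitrary: d L A)
  case 0
  then show ?case by (simp add: shadow_def)
next
  case (Suc m)
  obtain B where B: "B \<subseteq> mons (Suc m) d" "card B = card A" "borel_fixed (Suc m) B"
    and le: "card (shadow (Suc m) B) \<le> card (shadow (Suc m) A)"
    using borel_fixed_exists[OF Suc.prems(2)] by blast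
  note L = Suc.prems(1)
  have "card (lev m L 0) \<le> card (lev m B 0)"
    using card_lev_0_le[OF Suc.IH B(1,3) L] Suc.prems(3) B(2) by simp
  then have "card (shadow m (lev m L 0)) \<le> card (shadow m (lev m B 0))"
    using lexseg_lev[OF L, of 0] lev_mons[OF B(1), of 0] by (intro Suc.IH) auto
  then show ?case
    using card_shadow_borel_fixed[OF B(1,3)] le B(2) Suc.prems(3)
      card_shadow_borel_fixed[OF lexseg_mons[OF L] lexseg_borel_fixed[OF L]] by linarith
qed

section \<open>Sets of minimal growth\<close>

definition min_shadow :: "nat \<Rightarrow> nat \<Rightarrow> (nat \<Rightarrow> nat) set \<Rightarrow> bool" where
  "min_shadow m d A \<longleftrightarrow> A \<subseteq> mons m d \<and>
     (\<forall>B. B \<subseteq> mons m d \<longrightarrow> card B = card A \<longrightarrow> card (shadow m A) \<le> card (shadow m B))"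

lemma min_shadowI:
  assumes "A \<subseteq> mons m d" "lexseg m d L" "card L = card A" "card (shadow m A) \<le> card (shadow m L)"
  shows "min_shadow m d A"
  unfolding min_shadow_def
proof (intro conjI allI impI)
  fix B assume "B \<subseteq> mons m d" "card B = card A"
  then have "card (shadow m L) \<le> card (shadow m B)"
    using card_shadow_lexseg_le[OF assms(2)] assms(3) by simp
  then show "card (shadow m A) \<le> card (shadow m B)" using assms(4) by simp
qed (rule assms(1))

definition lexinit :: "nat \<Rightarrow> nat \<Rightarrow> nat \<Rightarrow> (nat \<Rightarrow> nat) set" where
  "lexinit m d n = (SOME L. lexseg m d L \<and> card L = n)"

lemma lexinit:
  assumes "n \<le> card (mons m d)"
  shows "lexseg m d (lexinit m d n)" "card (lexinit m d n) = n"
  using someI_ex[OF lexseg_exists[OF assms]] by (simp_all add: lexinit_def)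

locale min_growth =
  fixes m d :: nat and A :: "(nat \<Rightarrow> nat) set"
  assumes min_A: "min_shadow (Suc m) d A"
begin

lemma A_mons: "A \<subseteq> mons (Suc m) d"
  using min_A by (simp add: min_shadow_def)

abbreviation Al :: "nat \<Rightarrow> (nat \<Rightarrow> nat) set" where "Al \<equiv> lev m A"

definition L :: "nat \<Rightarrow> (nat \<Rightarrow> nat) set" where
  "L k = lexinit m (d - k) (card (Al k))"

text \<open>This rearrangement has the size of \<open>A\<close> and turns out to have minimal shadow
  too, so a compression of it cannot shrink the shadow.\<close>

definition D :: "(nat \<Rightarrow> nat) set" where
  "D = {u \<in> mons (Suc m) d. u(m := 0) \<in> L (u m)}"

lemma Al_mons: "Al k \<subseteq> mons m (d - k)"
  by (rule lev_mons[OF A_mons])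

lemma lexseg_L: "lexseg m (d - k) (L k)" and card_L [simp]: "card (L k) = card (Al k)"
  using lexinit[OF card_mono[OF finite_mons Al_mons], of k] by (simp_all add: L_def)

lemma card_shadow_L_le: "card (shadow m (L k)) \<le> card (shadow m (Al k))"
  by (rule card_shadow_lexseg_le[OF lexseg_L Al_mons]) simp

lemma L_empty: "d < k \<Longrightarrow> L k = {}"
  using card_L[of k] lev_empty[OF A_mons, of k] card_0_eq[OF lexseg_finite[OF lexseg_L], of k]
  by simp

lemma D_mons: "D \<subseteq> mons (Suc m) d"
  by (auto simp: D_def)

lemma lev_D: "lev m D k = L k"
proof (cases "k \<le> d")
  case True
  then show ?thesis
    using lexseg_mons[OF lexseg_L, of k] upd_mons_iff[of _ m k d]
    by (auto simp: lev_def D_def mons_def)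
next
  case False
  then show ?thesis using L_empty lev_empty[OF D_mons] by simp
qed

lemma card_D: "card D = card A"
  using card_eq_sum_lev[OF A_mons] card_eq_sum_lev[OF D_mons] by (simp add: lev_D)

lemma lexseg_shadow_L: "k < d \<Longrightarrow> lexseg m (d - k) (shadow m (L (Suc k)))"
  using shadow_lexseg[OF lexseg_L, of "Suc k"] by (simp add: Suc_diff_Suc)

lemma finite_shadow_L: "finite (shadow m (L k))"
  by (rule finite_shadow[OF lexseg_mons[OF lexseg_L]])

lemma card_shadow_L_Un:
  assumes "k \<le> d"
  shows "card (shadow m (L (Suc k)) \<union> L k) = max (card (shadow m (L (Suc k)))) (card (Al k))"
\<comment> \<open>For \<open>k < d\<close> the two sets are segments of the same degree, hence
  nested; for \<open>k = d\<close> the slice \<open>d + 1\<close> is empty.\<close>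
proof (cases "k = d")
  case False
  then have "lexseg m (d - k) (shadow m (L (Suc k)))" using assms lexseg_shadow_L by simp
  from lexseg_nested[OF this lexseg_L] show ?thesis
    using card_mono[OF finite_shadow_L, of "L k" "Suc k"]
      card_mono[OF lexseg_finite[OF lexseg_L], of "shadow m (L (Suc k))" k]
    by (auto simp: sup.absorb1 sup.absorb2 max.absorb1 max.absorb2)
qed (simp add: L_empty)

lemma card_shadow_D:
  "card (shadow (Suc m) D) = card (shadow m (L 0)) +
     (\<Sum>k\<le>d. max (card (shadow m (L (Suc k)))) (card (Al k)))"
  using card_shadow_eq_sum_lev[OF D_mons] card_shadow_L_Un by (simp add: lev_D)

lemma max_le_card_Un:
  "max (card (shadow m (L (Suc k)))) (card (Al k)) \<le> card (shadow m (Al (Suc k)) \<union> Al k)"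
proof -
  have fin: "finite (shadow m (Al (Suc k)) \<union> Al k)"
    using finite_shadow[OF Al_mons] finite_lev[OF A_mons] by simp
  have "card (shadow m (Al (Suc k))) \<le> card (shadow m (Al (Suc k)) \<union> Al k)"
    using fin by (intro card_mono) auto
  moreover have "card (Al k) \<le> card (shadow m (Al (Suc k)) \<union> Al k)"
    using fin by (intro card_mono) auto
  ultimately show ?thesis using card_shadow_L_le[of "Suc k"] by simp
qed

lemma card_shadow_A_le: "card (shadow (Suc m) A) \<le> card (shadow (Suc m) D)"
  using min_A D_mons card_D by (simp add: min_shadow_def)

text \<open>Slice by slice the shadow of \<open>A\<close> is at least as large as that of
  \<open>D\<close>, while by minimality its total is no larger. So all terms agree.\<close>

lemma card_shadow_Al_0: "card (shadow m (Al 0)) = card (shadow m (L 0))"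
  and card_shadow_Al_Un: "k \<le> d \<Longrightarrow>
    card (shadow m (Al (Suc k)) \<union> Al k) = max (card (shadow m (L (Suc k)))) (card (Al k))"
proof -
  let ?s = "\<Sum>k\<le>d. max (card (shadow m (L (Suc k)))) (card (Al k))"
  let ?t = "\<Sum>k\<le>d. card (shadow m (Al (Suc k)) \<union> Al k)"
  have st: "?s \<le> ?t" by (intro sum_mono max_le_card_Un)
  have *: "card (shadow m (Al 0)) + ?t \<le> card (shadow m (L 0)) + ?s"
    using card_shadow_A_le card_shadow_eq_sum_lev[OF A_mons] card_shadow_D by linarith
  then show "card (shadow m (Al 0)) = card (shadow m (L 0))"
    using card_shadow_L_le[of 0] st by linarith
  have "?s = ?t" using * card_shadow_L_le[of 0] st by linarith
  then show "card (shadow m (Al (Suc k)) \<union> Al k) = max (card (shadow m (L (Suc k)))) (card (Al k))"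
    if "k \<le> d"
    using sum_mono_inv[of "\<lambda>k. max (card (shadow m (L (Suc k)))) (card (Al k))" "{..d}"
        "\<lambda>k. card (shadow m (Al (Suc k)) \<union> Al k)" k] max_le_card_Un that by simp
qed

lemma min_shadow_Al:
  assumes "card (shadow m (Al k)) \<le> card (shadow m (L k))"
  shows "min_shadow m (d - k) (Al k)"
  using min_shadowI[OF Al_mons lexseg_L card_L assms] .

text \<open>The union forming slice \<open>k + 1\<close> of the shadow is as small as the shadow of
  the segment, so it equals its part \<open>shadow m (Al (Suc k))\<close>, and this part is
  minimal.\<close>

lemma upward:
  assumes "k \<le> d" "card (Al k) \<le> card (shadow m (L (Suc k)))"
  shows "Al k \<subseteq> shadow m (Al (Suc k))" "min_shadow m (d - Suc k) (Al (Suc k))"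
proof -
  have eq: "card (shadow m (Al (Suc k)) \<union> Al k) = card (shadow m (L (Suc k)))"
    using card_shadow_Al_Un[OF assms(1)] assms(2) by simp
  have fin: "finite (shadow m (Al (Suc k)) \<union> Al k)"
    using finite_shadow[OF Al_mons] finite_lev[OF A_mons] by simp
  then have "card (shadow m (Al (Suc k))) \<le> card (shadow m (L (Suc k)))"
    unfolding eq[symmetric] by (intro card_mono) auto
  then show "min_shadow m (d - Suc k) (Al (Suc k))" by (rule min_shadow_Al)
  have "shadow m (Al (Suc k)) = shadow m (Al (Suc k)) \<union> Al k"
    using fin card_shadow_L_le[of "Suc k"] eq by (intro card_seteq) auto
  then show "Al k \<subseteq> shadow m (Al (Suc k))" by blast
qed

lemma downward:
  assumes "k \<le> d" "card (shadow m (L (Suc k))) \<le> card (Al k)"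
  shows "shadow m (Al (Suc k)) \<subseteq> Al k"
proof -
  have eq: "card (shadow m (Al (Suc k)) \<union> Al k) = card (Al k)"
    using card_shadow_Al_Un[OF assms(1)] assms(2) by simp
  have fin: "finite (shadow m (Al (Suc k)) \<union> Al k)"
    using finite_shadow[OF Al_mons] finite_lev[OF A_mons] by simp
  have "Al k = shadow m (Al (Suc k)) \<union> Al k"
    using fin eq by (intro card_seteq) auto
  then show ?thesis by blast
qed

lemma card_shadow_D_le: "card (shadow (Suc m) D) \<le> card (shadow (Suc m) A)"
  unfolding card_shadow_D card_shadow_eq_sum_lev[OF A_mons]
  by (intro add_mono card_shadow_L_le sum_mono max_le_card_Un)

lemma min_shadow_D: "min_shadow (Suc m) d D"
  unfolding min_shadow_def
proof (intro conjI allI impI D_mons)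
  fix B assume "B \<subseteq> mons (Suc m) d" "card B = card D"
  then have "card (shadow (Suc m) A) \<le> card (shadow (Suc m) B)"
    using min_A card_D by (simp add: min_shadow_def)
  then show "card (shadow (Suc m) D) \<le> card (shadow (Suc m) B)" using card_shadow_D_le by simp
qed

text \<open>If the slice sizes went strictly down and later strictly up (relative to minimal growth), the
  lexicographic rearrangement \<open>D\<close> would have a gap in the direction of the variables \<open>t\<close> and \<open>m\<close>,
  where \<open>t\<close> is the last variable of the first monomial missing between the two places; then
  compression in these two variables would make the shadow smaller.\<close>

lemma no_gap_consecutive:
  assumes pq: "p < q" "q < d"
    and p: "card (shadow m (L (Suc p))) < card (Al p)"
    and q: "card (Al q) < card (shadow m (L (Suc q)))"
    and mid: "\<And>k. p < k \<Longrightarrow> k < q \<Longrightarrow> card (Al k) = card (shadow m (L (Suc k)))"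
  shows False
proof -
  have "L q \<noteq> mons m (d - q)"
  proof
    assume "L q = mons m (d - q)"
    then have "shadow m (L (Suc q)) \<subseteq> L q" using lexseg_mons[OF lexseg_shadow_L] pq by blast
    from card_mono[OF lexseg_finite[OF lexseg_L] this] show False using q by simp
  qed
  then obtain u where u: "first_out m (d - q) (L q) u" using first_out_ex[OF lexseg_L] by blast
  have um: "u \<in> mons m (d - q)" using u by (simp add: first_out_def)
  have "d - q = Suc (d - Suc q)" using pq by simp
  then obtain t where t: "t < m" "top_var u t" using top_var_ex[of u m "d - Suc q"] um by metis
  \<comment> \<open>Between \<open>p\<close> and \<open>q\<close> each segment is the shadow of the
    next one, so multiplying by \<open>t\<close> carries the first missing monomial from slice to
    slice.\<close>
  define U where "U k = u(t := u t + (q - k))" for k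
  have top_U: "top_var (U k) t" for k using t by (auto simp: U_def top_var_def)
  have U_Suc: "U k = inc t (U (Suc k))" if "k < q" for k
    using that by (auto simp: U_def inc_def Suc_diff_Suc)
  have fo: "first_out m (d - k) (shadow m (L (Suc k))) (U k)"
    if "k < q" "first_out m (d - Suc k) (L (Suc k)) (U (Suc k))" for k
  proof -
    have "d - Suc k = Suc (d - Suc (Suc k))" "d - k = Suc (Suc (d - Suc (Suc k)))"
      using that pq by auto
    then show ?thesis
      using first_out_shadow(1)[of m "d - Suc (Suc k)" "L (Suc k)" "U (Suc k)" t] that top_U
        U_Suc by simp
  qed
  have U: "first_out m (d - k) (L k) (U k)" if "p < k" "k \<le> q" for k
    using that(2,1)
  proof (induction k rule: inc_induct)
    case base
    then show ?case using u by (simp add: U_def)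
  next
    case (step k)
    have "L k = shadow m (L (Suc k))"
      using mid[of k] step pq lexseg_card_subset[OF lexseg_L lexseg_shadow_L, of k]
        lexseg_card_subset[OF lexseg_shadow_L lexseg_L, of k] by auto
    then show ?case using fo[of k] step by simp
  qed
  have Up: "U p \<in> L p"
  proof (rule lexseg_first_out_in)
    show "first_out m (d - p) (shadow m (L (Suc p))) (U p)" using fo[of p] U[of "Suc p"] pq by simp
    show "lexseg m (d - p) (L p)" by (rule lexseg_L)
    show "\<not> L p \<subseteq> shadow m (L (Suc p))" using p card_mono[OF finite_shadow_L, of "L p" "Suc p"] by auto
  qed
  have "u \<in> shadow m (L (Suc q))"
  proof (rule lexseg_first_out_in[OF u])
    show "lexseg m (d - q) (shadow m (L (Suc q)))" using lexseg_shadow_L pq by blast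
    show "\<not> shadow m (L (Suc q)) \<subseteq> L q"
      using q card_mono[OF lexseg_finite[OF lexseg_L], of "shadow m (L (Suc q))" q] by auto
  qed
  then have dec_u: "dec t u \<in> L (Suc q)" using lexseg_dec_top[OF lexseg_L _ t(2)] by blast
  \<comment> \<open>All three lie in one group of the variables \<open>t\<close> and
    \<open>m\<close>, with exponents \<open>q + 1\<close>, \<open>p\<close> and \<open>p + 1\<close>
    of \<open>m\<close>. The strict inequalities at \<open>q\<close> and \<open>p\<close> put
    \<alpha> and \<beta> into \<open>D\<close>; the missing \<gamma> is the gap.\<close>
  define \<alpha> \<beta> \<gamma> where "\<alpha> = (dec t u)(m := Suc q)" and "\<beta> = (U p)(m := p)"
    and "\<gamma> = (U (Suc p))(m := Suc p)"
  have \<alpha>: "\<alpha> \<in> D" using dec_u unfolding \<alpha>_def lev_D[symmetric] by (simp add: lev_def)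
  have \<beta>: "\<beta> \<in> D" using Up unfolding \<beta>_def lev_D[symmetric] by (simp add: lev_def)
  have out: "U (Suc p) \<notin> L (Suc p)" using first_out_notin U[of "Suc p"] pq by auto
  have UN: "U k \<in> Nvec m" for k using um t by (auto simp: U_def mons_def Nvec_def)
  have USp: "U (Suc p) \<in> mons m (d - Suc p)" using U[of "Suc p"] pq by (simp add: first_out_def)
  interpret var_pair t m "Suc m" using t by unfold_locales auto
  have "card (shadow (Suc m) (pcomp t m (Suc m) d D)) < card (shadow (Suc m) D)"
  proof (rule card_shadow_C_less[OF D_mons \<beta> \<alpha>])
    show "rest t m \<alpha> = rest t m \<beta>"
      using t by (auto simp: rest_def \<alpha>_def \<beta>_def U_def dec_def)
    show "Suc (\<beta> m) < \<alpha> m" using pq by (simp add: \<alpha>_def \<beta>_def)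
  next
    fix x assume x: "x \<in> D" "rest t m x = rest t m \<beta>"
    show "x m \<noteq> Suc (\<beta> m)"
    proof
      assume xm: "x m = Suc (\<beta> m)"
      have "\<gamma> \<in> mons (Suc m) d"
        using USp upd_mons_iff[OF UN, of "Suc p" "Suc p" d] pq by (simp add: \<gamma>_def)
      moreover have "rest t m \<gamma> = rest t m \<beta>"
        by (auto simp: rest_def \<gamma>_def \<beta>_def U_def)
      moreover have "\<gamma> m = x m" using xm by (simp add: \<gamma>_def \<beta>_def)
      ultimately have "x = \<gamma>"
        using inj_onD[OF inj_F[OF order_refl], of x \<gamma> d "rest t m \<beta>"] x D_mons
        by (auto simp: fib_def)
      then have "U (Suc p) \<in> lev m D (Suc p)" using x UN by (simp add: lev_def \<gamma>_def)
      then show False using out by (simp add: lev_D)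
    qed
  next
    fix z assume z: "z \<noteq> t" "z \<noteq> m" "0 < \<beta> z"
    have Uz: "0 < U p z" using z by (simp add: \<beta>_def)
    then have zt: "z < t" using top_U[of p] z(1) by (metis less_irrefl linorder_neqE_nat top_var_def)
    show "dec z (inc m \<beta>) \<notin> D"
    proof
      assume "dec z (inc m \<beta>) \<in> D"
      moreover have "dec z (inc m \<beta>) = (dec z (U p))(m := Suc p)"
        using z by (auto simp: dec_def inc_def \<beta>_def)
      ultimately have "dec z (U p) \<in> lev m D (Suc p)" using UN by (simp add: lev_def dec_in_Nvec)
      then have "dec z (U p) \<in> L (Suc p)" by (simp add: lev_D)
      \<comment> \<open>As \<open>z\<close> precedes \<open>t\<close>, dividing \<open>U p\<close>
        by \<open>z\<close> gives less than dividing it by \<open>t\<close>, which is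
        \<open>U (Suc p)\<close>.\<close>
      moreover have "lexless (dec z (U p)) (U (Suc p))" unfolding lexless_def
        using zt Uz by (intro exI[of _ z]) (auto simp: dec_apply U_def)
      ultimately show False using lexsegD[OF lexseg_L] USp out by blast
    qed
  qed
  moreover have "card (shadow (Suc m) D) \<le> card (shadow (Suc m) (pcomp t m (Suc m) d D))"
    using min_shadow_D C_mons card_C[OF D_mons] by (simp add: min_shadow_def)
  ultimately show False by simp
qed

text \<open>By induction on the distance: a strict inequality between \<open>p\<close> and
  \<open>q\<close>, in either direction, would give a closer pair.\<close>

lemma no_gap:
  assumes "p < q" "q < d"
    and "card (shadow m (L (Suc p))) < card (Al p)"
    and "card (Al q) < card (shadow m (L (Suc q)))"
  shows False
  using assms
proof (induction "q - p" arbitrary: p q rule: less_induct)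
  case less
  show False
  proof (rule no_gap_consecutive[OF less.prems])
    fix k assume "p < k" "k < q"
    then have "k - p < q - p" "q - k < q - p" by linarith+
    with \<open>p < k\<close> \<open>k < q\<close> show "card (Al k) = card (shadow m (L (Suc k)))"
      using less.hyps[of k p] less.hyps[of q k] less.prems
      by (cases "card (Al k)" "card (shadow m (L (Suc k)))" rule: linorder_cases) auto
  qed
qed

end

section \<open>Connectedness\<close>

text \<open>The exchange of variables is expressed by a common multiple: this is symmetric and later
  bounds the degree of the LUB of divisors. For \<open>i = j\<close> it relates \<open>u\<close>
  only to itself.\<close>

definition adj ::
  "nat \<Rightarrow> (nat \<Rightarrow> nat) set \<Rightarrow> (nat \<Rightarrow> nat) \<Rightarrow> (nat \<Rightarrow> nat) \<Rightarrow> (nat \<Rightarrow> nat) \<Rightarrow> bool" where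
  "adj m A \<tau> u v \<longleftrightarrow> u \<in> A \<and> v \<in> A \<and> u \<le> \<tau> \<and> v \<le> \<tau> \<and> (\<exists>i<m. \<exists>j<m. inc i u = inc j v)"

lemma adj_sym: "adj m A \<tau> u v \<Longrightarrow> adj m A \<tau> v u"
  by (auto simp: adj_def) metis

lemma adj_rtranclp_sym: "(adj m A \<tau>)\<^sup>*\<^sup>* u v \<Longrightarrow> (adj m A \<tau>)\<^sup>*\<^sup>* v u"
  by (induction rule: rtranclp_induct) (auto intro: converse_rtranclp_into_rtranclp adj_sym)

lemma adj_lev:
  assumes "(adj m (lev m A k) \<tau>)\<^sup>*\<^sup>* u v" "k \<le> \<tau> m"
  shows "(adj (Suc m) A \<tau>)\<^sup>*\<^sup>* (u(m := k)) (v(m := k))"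
  using assms(1)
proof (induction rule: rtranclp_induct)
  case (step v w)
  obtain i j where ij: "i < m" "j < m" "inc i v = inc j w" using step(2) by (auto simp: adj_def)
  have "inc i (v(m := k)) = (inc i v)(m := k)" "inc j (w(m := k)) = (inc j w)(m := k)"
    using ij(1,2) by (auto simp: inc_def fun_upd_twist)
  then have "inc i (v(m := k)) = inc j (w(m := k))" using ij(3) by metis
  then have "adj (Suc m) A \<tau> (v(m := k)) (w(m := k))"
    using step(2) assms(2) ij by (auto simp: adj_def lev_def le_fun_def intro: less_SucI)
  with step.IH show ?case by (metis rtranclp.rtrancl_into_rtrancl)
qed simp

context min_growth
begin

text \<open>Let \<open>s\<close> be the first slice from which all moves can go down. The comparison
  at \<open>s - 1\<close> then strictly favours moving up, and \<open>no_gap\<close> excludes a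
  strict preference for moving down earlier.\<close>

lemma turning_point:
  obtains s where "s \<le> d"
    "\<And>k. k < s \<Longrightarrow> card (Al k) \<le> card (shadow m (L (Suc k)))"
    "\<And>k. s \<le> k \<Longrightarrow> k < d \<Longrightarrow> card (shadow m (L (Suc k))) \<le> card (Al k)"
proof -
  define P where "P s \<longleftrightarrow> (\<forall>k. s \<le> k \<longrightarrow> k < d \<longrightarrow> card (shadow m (L (Suc k))) \<le> card (Al k))" for s
  define s where "s = (LEAST s. P s)"
  have Pd: "P d" by (simp add: P_def)
  have Ps: "P s" unfolding s_def using Pd by (rule LeastI)
  have sd: "s \<le> d" unfolding s_def using Pd by (rule Least_le)
  have "card (Al k) \<le> card (shadow m (L (Suc k)))" if k: "k < s" for k
  proof (rule ccontr)
    assume *: "\<not> ?thesis"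
    have "\<not> P (s - 1)" using k not_less_Least[of "s - 1" P] unfolding s_def by simp
    then obtain q where q: "s - 1 \<le> q" "q < d" "card (Al q) < card (shadow m (L (Suc q)))"
      by (auto simp: P_def not_le)
    have "\<not> s \<le> q" using Ps q by (auto simp: P_def)
    then have "q = s - 1" using q by simp
    moreover have "k \<noteq> q" using * q by auto
    ultimately have "k < q" using k by linarith
    then show False using no_gap[of k q] q * by simp
  qed
  then show ?thesis using that[OF sd] Ps by (auto simp: P_def)
qed

lemma connected:
  assumes IH: "\<And>e B u v. min_shadow m e B \<Longrightarrow> u \<in> B \<Longrightarrow> v \<in> B \<Longrightarrow> u \<le> \<tau> \<Longrightarrow> v \<le> \<tau> \<Longrightarrow>
      (adj m B \<tau>)\<^sup>*\<^sup>* u v"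
    and u: "u \<in> A" "u \<le> \<tau>" and v: "v \<in> A" "v \<le> \<tau>"
  shows "(adj (Suc m) A \<tau>)\<^sup>*\<^sup>* u v"
proof -
  obtain s where s: "s \<le> d"
    and up: "\<And>k. k < s \<Longrightarrow> card (Al k) \<le> card (shadow m (L (Suc k)))"
    and down: "\<And>k. s \<le> k \<Longrightarrow> k < d \<Longrightarrow> card (shadow m (L (Suc k))) \<le> card (Al k)"
    using turning_point by blast
  \<comment> \<open>The meeting slice is the turning point, capped by the exponent that \<tau>
    allows, but not below \<open>d - deg m \<tau>\<close>, the least exponent of \<open>m\<close> in
    a monomial of degree \<open>d\<close> below \<tau>. Here \<open>deg m\<close> omits the variable
    \<open>m\<close>.\<close>
  define T where "T = max (min s (\<tau> m)) (d - deg m \<tau>)"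
  have slice: "x(m := 0) \<in> Al (x m)" "x(m := 0) \<in> mons m (d - x m)" "x m \<le> d" "x(m := 0) \<le> \<tau>"
    "x m \<le> \<tau> m" "d - x m \<le> deg m \<tau>" if "x \<in> A" "x \<le> \<tau>" for x
  proof -
    have xm: "x \<in> mons (Suc m) d" using that A_mons by blast
    then show 1: "x(m := 0) \<in> Al (x m)" using that by (intro upd_last_mem_lev) (auto simp: mons_def)
    then show 2: "x(m := 0) \<in> mons m (d - x m)" using Al_mons by blast
    show "x m \<le> d" using xm by (auto simp: mons_def)
    show "x(m := 0) \<le> \<tau>" "x m \<le> \<tau> m" using that by (auto simp: le_fun_def)
    then have "deg m (x(m := 0)) \<le> deg m \<tau>" 
      by (intro deg_mono) (rule le_funD)
    then show "d - x m \<le> deg m \<tau>" using mons_deg[OF 2] by simp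
  qed
  have to_T: "\<exists>y. y \<in> A \<and> y \<le> \<tau> \<and> y m = T \<and> (adj (Suc m) A \<tau>)\<^sup>*\<^sup>* x y"
    if "x \<in> A" "x \<le> \<tau>" for x
    using that
  \<comment> \<open>With truncated subtraction this sum is the distance to slice
    \<open>T\<close>.\<close>
  proof (induction "(x m - T) + (T - x m)" arbitrary: x rule: less_induct)
    case less
    note x = slice[OF less.prems]
    have x0: "x = (x(m := 0))(m := x m)" by simp
    have step: ?case if y: "y \<in> A" "y \<le> \<tau>" "(y m - T) + (T - y m) < (x m - T) + (T - x m)"
      "i < Suc m" "j < Suc m" "inc i x = inc j y" for y i j
    proof -
      obtain z where z: "z \<in> A" "z \<le> \<tau>" "z m = T" "(adj (Suc m) A \<tau>)\<^sup>*\<^sup>* y z"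
        using less.hyps[OF y(3,1,2)] by blast
      have "adj (Suc m) A \<tau> x y" using y less.prems by (auto simp: adj_def)
      then show ?thesis using z converse_rtranclp_into_rtranclp by metis
    qed
    consider "x m = T" | "x m < T" | "T < x m" by linarith
    then show ?case
    proof cases
      case 1
      then show ?thesis using less.prems by blast
    next
      case 2
      then have k: "x m < s" "x m < \<tau> m" using x(6,3) by (auto simp: T_def)
      \<comment> \<open>Upward move: an earlier variable is exchanged for \<open>m\<close>, which
        still has room below \<tau>.\<close>
      have "x(m := 0) \<in> shadow m (Al (Suc (x m)))"
        using upward(1)[of "x m"] up[of "x m"] k s x(1,3) by auto
      then obtain i w where w: "i < m" "w \<in> Al (Suc (x m))" "x(m := 0) = inc i w"
        by (auto elim: shadowE)
      define y where "y = w(m := Suc (x m))"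
      have "inc m x = inc i y"
      proof -
        have "inc m x = (x(m := 0))(m := Suc (x m))" by (simp add: inc_def)
        also have "\<dots> = inc i y" unfolding w(3) y_def using w(1) by (auto simp: inc_def)
        finally show ?thesis .
      qed
      moreover have "w a \<le> \<tau> a" for a
      proof -
        have "w a \<le> inc i w a" by (simp add: inc_apply)
        also have "\<dots> \<le> \<tau> a" using x(4) unfolding w(3)[symmetric] by (simp add: le_fun_def)
        finally show ?thesis .
      qed
      then have "y \<le> \<tau>" using k by (auto simp: y_def le_fun_def)
      moreover have "y \<in> A" using w by (simp add: y_def lev_def)
      ultimately show ?thesis using 2 w(1) by (intro step[of y m i]) (auto simp: y_def)
    next
      case 3
      have "s < x m" using 3 x(5) by (auto simp: T_def min_def split: if_splits)
      then obtain k where k: "x m = Suc k" "s \<le> k" by (cases "x m") auto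
      have kd: "k < d" using x(3) k by simp
      have "d - x m < deg m \<tau>" using 3 x(3) by (auto simp: T_def)
      then have less: "\<not> deg m \<tau> \<le> deg m (x(m := 0))" using mons_deg[OF x(2)] by simp
      \<comment> \<open>Downward move: \<open>m\<close> is exchanged for a variable with room below
        \<tau>. One exists because the exponent of \<open>m\<close> exceeds the least possible
        value.\<close>
      have "\<exists>i<m. x i < \<tau> i"
      proof (rule ccontr)
        assume "\<not> ?thesis"
        then have "\<tau> i \<le> x i" if "i < m" for i using that by (meson not_less)
        then have "deg m \<tau> \<le> deg m (x(m := 0))" by (intro deg_mono) auto
        then show False using less by blast
      qed
      then obtain i where i: "i < m" "x i < \<tau> i" by blast
      have "inc i (x(m := 0)) \<in> Al k"
        using downward[of k] down[OF k(2) kd] kd shadowI[OF x(1) i(1)] k(1) by auto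
      define y where "y = (inc i (x(m := 0)))(m := k)"
      have "y \<in> A" using \<open>inc i (x(m := 0)) \<in> Al k\<close> by (simp add: y_def lev_def)
      moreover have "y \<le> \<tau>" using less.prems(2) i x(5) k(1)
        by (auto simp: y_def le_fun_def inc_apply Suc_le_eq)
      moreover have "inc i x = inc m y" using i k(1) by (auto simp: y_def inc_def fun_eq_iff)
      ultimately show ?thesis using 3 i(1) k(1) by (intro step[of y i m]) (auto simp: y_def)
    qed
  qed
  have at_T: "(adj (Suc m) A \<tau>)\<^sup>*\<^sup>* x y"
    if x: "x \<in> A" "x \<le> \<tau>" "x m = T" and y: "y \<in> A" "y \<le> \<tau>" "y m = T" for x y
  proof (cases "T \<le> s")
    case True
    \<comment> \<open>Up to the turning point slices inherit minimality, from the upward move into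
      them or, for slice 0, from the equality of shadow sizes.\<close>
    have "min_shadow m (d - T) (Al T)"
    proof (cases T)
      case 0
      then show ?thesis using min_shadow_Al[of 0] card_shadow_Al_0 by simp
    next
      case (Suc k)
      then show ?thesis using upward(2)[of k] up[of k] True s by simp
    qed
    then have "(adj m (Al T) \<tau>)\<^sup>*\<^sup>* (x(m := 0)) (y(m := 0))"
      using slice[OF x(1,2)] slice[OF y(1,2)] x(3) y(3) by (intro IH) auto
    from adj_lev[OF this] show ?thesis
      using slice(5)[OF x(1,2)] x(3) y(3) by (metis fun_upd_triv fun_upd_upd)
  next
    case False
    then have T: "T = d - deg m \<tau>" by (auto simp: T_def)
    \<comment> \<open>Past the turning point \<open>T\<close> is the least possible exponent, so an
      element of the slice below \<tau> exhausts \<tau> in all other variables: there is at most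
      one.\<close>
    define \<sigma> where "\<sigma> = (\<lambda>i. if i < m then \<tau> i else 0)"
    have "deg m \<sigma> = deg m \<tau>" by (intro deg_cong) (simp add: \<sigma>_def)
    then have \<sigma>: "\<sigma> \<in> mons m (d - T)" using T False
      by (auto simp: mons_def Nvec_def \<sigma>_def)
    have "z(m := 0) = \<sigma>" if "z \<in> A" "z \<le> \<tau>" "z m = T" for z
      using slice(2)[OF that(1,2)] that(3) \<sigma> le_funD[OF that(2)]
      by (intro mons_eqI[of _ m "d - T"]) (auto simp: \<sigma>_def)
    from this[OF x] this[OF y] have "x = y" using x(3) y(3) by (metis fun_upd_triv fun_upd_upd)
    then show ?thesis by simp
  qed
  obtain x y where "x \<in> A" "x \<le> \<tau>" "x m = T" "(adj (Suc m) A \<tau>)\<^sup>*\<^sup>* u x"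
    and "y \<in> A" "y \<le> \<tau>" "y m = T" "(adj (Suc m) A \<tau>)\<^sup>*\<^sup>* v y"
    using to_T[OF u] to_T[OF v] by blast
  then show ?thesis using at_T[of x y] adj_rtranclp_sym by (meson rtranclp_trans)
qed

end

theorem min_shadow_connected:
  assumes "min_shadow m d A" "u \<in> A" "v \<in> A" "u \<le> \<tau>" "v \<le> \<tau>"
  shows "(adj m A \<tau>)\<^sup>*\<^sup>* u v"
  using assms
proof (induction m arbitrary: d A u v)
  case 0
  then have "u \<in> mons 0 d" "v \<in> mons 0 d" by (auto simp: min_shadow_def)
  then have "u = v" by (intro mons_eqI) auto
  then show ?case by simp
next
  case (Suc m)
  then interpret min_growth m d A by unfold_locales
  show ?case using Suc by (intro connected) auto
qed

section \<open>Counting the complement of a lexicographic segment\<close>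

lemma mons_zero_Suc [simp]: "mons 0 (Suc e) = {}"
  by (auto simp: mons_def deg_def)

text \<open>Pascal's rule: separate the monomials without the last variable from its
  multiples.\<close>

lemma card_mons_eq: "card (mons (Suc m) d) = (m + d) choose d"
proof (induction "m + d" arbitrary: m d)
  case 0
  then show ?case by simp
next
  case (Suc n)
  show ?case
  proof (cases d)
    case (Suc e)
    have "card (mons (Suc m) (Suc e)) = card (lev m (mons (Suc m) (Suc e)) 0) + card (quo m (mons (Suc m) (Suc e)))"
      by (rule card_quo[OF order_refl])
    also have "quo m (mons (Suc m) (Suc e)) = mons (Suc m) e"
      by (auto simp: quo_def mons_def deg_inc inc_in_Nvec simp del: deg_Suc)
    also have "lev m (mons (Suc m) (Suc e)) 0 = mons m (Suc e)"
      by (auto simp: lev_def mons_def Nvec_def)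
    finally have *: "card (mons (Suc m) (Suc e)) = card (mons m (Suc e)) + card (mons (Suc m) e)" .
    show ?thesis
    proof (cases m)
      case 0
      then show ?thesis using * Suc.hyps(1)[of 0 e] Suc.hyps(2) \<open>d = Suc e\<close> 0 by simp
    next
      case (Suc l)
      then show ?thesis using * Suc.hyps(1)[of l "Suc e"] Suc.hyps(1)[of m e] Suc.hyps(2) \<open>d = Suc e\<close>
        by simp
    qed
  qed simp
qed

definition below :: "nat \<Rightarrow> nat \<Rightarrow> (nat \<Rightarrow> nat) \<Rightarrow> (nat \<Rightarrow> nat) set" where
  "below m d u = {v \<in> mons m d. lexless v u}"

definition bot_var :: "(nat \<Rightarrow> nat) \<Rightarrow> nat \<Rightarrow> bool" where
  "bot_var u c \<longleftrightarrow> 0 < u c \<and> (\<forall>i<c. u i = 0)"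

lemma bot_var_ex:
  assumes "u \<in> mons m (Suc d)" obtains c where "c < m" "bot_var u c"
proof -
  obtain i where i: "i < m" "0 < u i" using mons_ex_pos[OF assms] by blast
  define c where "c = (LEAST i. 0 < u i)"
  have "0 < u c" unfolding c_def using i(2) by (rule LeastI)
  moreover have "u k = 0" if "k < c" for k using not_less_Least that unfolding c_def by blast
  ultimately show ?thesis using that[of c] mons_pos_less[OF assms] by (simp add: bot_var_def)
qed

definition shift :: "nat \<Rightarrow> (nat \<Rightarrow> nat) \<Rightarrow> nat \<Rightarrow> nat" where
  "shift c u = (\<lambda>i. u (i + c))"

lemma card_mons_vanishing:
  "card {v \<in> mons (c + m) d. \<forall>i<c. v i = 0} = card (mons m d)"
proof (rule bij_betw_same_card)
  have deg: "deg (c + m) v = deg m (shift c v)" if "\<forall>i<c. v i = 0" for v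
  proof -
    have "deg (c + m) v = (\<Sum>i\<in>{c..<c + m}. v i)"
      unfolding deg_def by (rule sum.mono_neutral_right) (use that in auto)
    also have "\<dots> = (\<Sum>i<m. v (i + c))"
      using sum.shift_bounds_nat_ivl[of v 0 c m] by (simp add: add.commute atLeast0LessThan)
    finally show ?thesis by (simp add: deg_def shift_def)
  qed
  show "bij_betw (shift c) {v \<in> mons (c + m) d. \<forall>i<c. v i = 0} (mons m d)"
  proof (rule bij_betw_byWitness[where f' = "\<lambda>w i. if i < c then 0 else w (i - c)"])
    show "shift c ` {v \<in> mons (c + m) d. \<forall>i<c. v i = 0} \<subseteq> mons m d"
      using deg by (auto simp: mons_def Nvec_def shift_def)
    show "(\<lambda>w i. if i < c then 0 else w (i - c)) ` mons m d \<subseteq> {v \<in> mons (c + m) d. \<forall>i<c. v i = 0}"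
      using deg[of "\<lambda>i. if i < c then 0 else w (i - c)" for w]
      by (auto simp: mons_def Nvec_def shift_def)
  qed (auto simp: shift_def fun_eq_iff)
qed

text \<open>A monomial below \<open>u\<close> has no variable before \<open>c\<close>. Either it
  also avoids \<open>c\<close>, and then it is an arbitrary monomial in the later variables, or
  \<open>c\<close> can be cancelled from both.\<close>

lemma card_below:
  assumes u: "u \<in> mons m (Suc d)" and c: "bot_var u c"
  shows "card (below m (Suc d) u) = card (mons (m - Suc c) (Suc d)) + card (below m d (dec c u))"
proof -
  have cm: "c < m" using c u by (auto simp: bot_var_def intro: mons_pos_less)
  let ?Z = "{v \<in> mons m (Suc d). \<forall>i<Suc c. v i = 0}"
  have "below m (Suc d) u = ?Z \<union> inc c ` below m d (dec c u)"
  proof (intro set_eqI iffI)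
    fix v assume "v \<in> below m (Suc d) u"
    then have v: "v \<in> mons m (Suc d)" "lexless v u" by (auto simp: below_def)
    then obtain k where k: "v k < u k" "\<forall>i<k. v i = u i" by (auto simp: lexless_def)
    have "c \<le> k" using c k(1) by (metis bot_var_def less_nat_zero_code not_le)
    show "v \<in> ?Z \<union> inc c ` below m d (dec c u)"
    proof (cases "v c = 0")
      case True
      then show ?thesis using v(1) k c \<open>c \<le> k\<close> by (auto simp: less_Suc_eq bot_var_def)
    next
      case False
      then have "dec c v \<in> mons m d" "v = inc c (dec c v)" using v(1) cm by (auto simp: mons_dec)
      moreover have "lexless (dec c v) (dec c u)"
        using v(2) lexless_inc[of "dec c v" "dec c u" c] False c by (simp add: bot_var_def)
      ultimately show ?thesis by (auto simp: below_def)
    qed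
  next
    fix v assume "v \<in> ?Z \<union> inc c ` below m d (dec c u)"
    then show "v \<in> below m (Suc d) u"
    proof
      assume v: "v \<in> ?Z"
      then have "lexless v u" using c unfolding lexless_def bot_var_def by (intro exI[of _ c]) auto
      then show ?thesis using v by (simp add: below_def)
    next
      assume "v \<in> inc c ` below m d (dec c u)"
      then obtain w where w: "w \<in> mons m d" "lexless w (dec c u)" "v = inc c w"
        by (auto simp: below_def)
      then have "lexless v u" using lexless_inc[of w "dec c u" c] c by (simp add: bot_var_def)
      then show ?thesis using w cm by (simp add: below_def mons_inc)
    qed
  qed
  moreover have "?Z \<inter> inc c ` below m d (dec c u) = {}" by (auto simp: inc_apply)
  moreover have "finite ?Z" "finite (below m d (dec c u))" by (auto simp: below_def)
  ultimately have "card (below m (Suc d) u) = card ?Z + card (inc c ` below m d (dec c u))"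
    by (simp add: card_Un_disjoint)
  moreover have "card ?Z = card (mons (m - Suc c) (Suc d))"
    using card_mons_vanishing[of "Suc c" "m - Suc c" "Suc d"] cm by simp
  moreover have "card (inc c ` below m d (dec c u)) = card (below m d (dec c u))"
    by (rule card_image) (meson inj_inc inj_on_subset subset_UNIV)
  ultimately show ?thesis by simp
qed

text \<open>The Macaulay representation of the number of monomials below \<open>u\<close> is read off the variables of
  \<open>u\<close> in increasing order; multiplying \<open>u\<close> by the last variable \<open>m\<close> adds a vanishing term.\<close>

lemma below_macaulay_rep:
  assumes "u \<in> mons (Suc m) d"
  shows "below (Suc m) d u = {} \<and> below (Suc m) (Suc d) (inc m u) = {} \<or>
    (\<exists>j k. macaulay_rep d (card (below (Suc m) d u)) j k \<and>
       (\<forall>c. bot_var u c \<longrightarrow> c < m \<and> k d = (m - Suc c) + d) \<and>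
       card (below (Suc m) (Suc d) (inc m u)) = (\<Sum>i=j..d. (k i + 1) choose (i + 1)))"
  using assms
proof (induction d arbitrary: u)
  case 0
  have "\<not> lexless v (inc m (\<lambda>_. 0))"
    if "v \<in> mons (Suc m) 1" for v
  proof (cases "v m = 0")
    case True
    obtain i where i: "i < Suc m" "0 < v i"
      by (rule mons_ex_pos[of v "Suc m" 0]) (use \<open>v \<in> mons (Suc m) 1\<close> in simp)
    have "i < m" using True i by (auto simp: less_Suc_eq)
    have False if less: "lexless v (inc m (\<lambda>_. 0))"
    proof -
      obtain c where c: "v c < inc m (\<lambda>_. 0) c" "\<forall>i<c. v i = inc m (\<lambda>_. 0) i"
        using less by (auto simp: lexless_def)
      then have "c = m" by (simp add: inc_apply split: if_splits)
      then show False using c(2) \<open>i < m\<close> i(2) by (simp add: inc_apply)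
    qed
    then show ?thesis by blast
  next
    case False
    then have "inc m (\<lambda>_. 0) = v"
      using \<open>v \<in> mons (Suc m) 1\<close>
      by (intro mons_eqI[of _ "Suc m" 1]) (auto simp: inc_apply mons_def Nvec_def deg_def inc_def)
    then show ?thesis by auto
  qed
  then have "below (Suc m) (Suc 0) (inc m (\<lambda>_. 0)) = {}" by (auto simp: below_def)
  moreover have "below (Suc m) 0 (\<lambda>_. 0) = {}" by (auto simp: below_def)
  ultimately show ?case using 0 by simp
next
  case (Suc d)
  obtain c where c: "c < Suc m" "bot_var u c" using bot_var_ex[OF Suc.prems] by blast
  define u' where "u' = dec c u"
  have u': "u' \<in> mons (Suc m) d" using Suc.prems c by (simp add: u'_def mons_dec bot_var_def)
  have bot: "c' = c" if "bot_var u c'" for c'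
    using that c(2) by (metis bot_var_def less_irrefl linorder_neqE_nat)
  have bot': "c \<le> c'" if "bot_var u' c'" for c'
    using that c(2) by (auto simp: bot_var_def u'_def dec_apply not_less[symmetric] split: if_splits)
  have c1: "card (below (Suc m) (Suc d) u) = card (mons (m - c) (Suc d)) + card (below (Suc m) d u')"
    using card_below[OF Suc.prems c(2)] by (simp add: u'_def)
  have "bot_var (inc m u) c" using c by (auto simp: bot_var_def inc_apply)
  moreover have "dec c (inc m u) = inc m u'"
    using c(2) by (auto simp: u'_def dec_def inc_def bot_var_def fun_eq_iff)
  ultimately have c2: "card (below (Suc m) (Suc (Suc d)) (inc m u)) =
      card (mons (m - c) (Suc (Suc d))) + card (below (Suc m) (Suc d) (inc m u'))"
    using card_below[OF mons_inc[OF Suc.prems], of m c] by simp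
  have fin: "finite (below (Suc m) e w)" for e w by (simp add: below_def)
  show ?case
  proof (cases "c = m")
    case True
    \<comment> \<open>Here \<open>u\<close> is a power of the last variable and nothing lies below
      it: a representation from the induction hypothesis would need a first variable of
      \<open>u'\<close> before \<open>m\<close>.\<close>
    have "\<not> macaulay_rep d a j k \<or> (\<exists>c'. bot_var u' c' \<and> m \<le> c')" for a j k
    proof (cases d)
      case (Suc e)
      then show ?thesis using bot_var_ex[of u' "Suc m" e] u' bot' True by metis
    qed (simp add: macaulay_rep_def)
    then have "below (Suc m) d u' = {} \<and> below (Suc m) (Suc d) (inc m u') = {}"
      using Suc.IH[OF u'] by (meson not_le)
    then show ?thesis using c1 c2 True fin by (auto simp: card_eq_0_iff)
  next
    case False
    then have cm: "c < m" using c by simp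
    define K where "K = (m - Suc c) + Suc d"
    have mc: "m - c = Suc (m - Suc c)" using cm by simp
    have k1: "card (mons (m - c) (Suc d)) = K choose Suc d"
      unfolding mc card_mons_eq K_def ..
    have k2: "card (mons (m - c) (Suc (Suc d))) = (K + 1) choose (Suc d + 1)"
      unfolding mc card_mons_eq K_def by simp
    from Suc.IH[OF u'] show ?thesis
    proof (elim disjE exE conjE)
      assume e: "below (Suc m) d u' = {}" "below (Suc m) (Suc d) (inc m u') = {}"
      have 1: "macaulay_rep (Suc d) (card (below (Suc m) (Suc d) u)) (Suc d) (\<lambda>_. K)"
        using c1 k1 e by (simp add: macaulay_rep_def K_def)
      have 2: "\<forall>c'. bot_var u c' \<longrightarrow> c' < m \<and> K = (m - Suc c') + Suc d"
        using cm bot by (auto simp: K_def)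
      have 3: "card (below (Suc m) (Suc (Suc d)) (inc m u)) =
          (\<Sum>i=Suc d..Suc d. (K + 1) choose (i + 1))" using c2 k2 e by simp
      show ?thesis
        by (intro disjI2 exI[of _ "Suc d"] exI[of _ "\<lambda>_. K"] conjI 1 2 3)
    next
      fix j k
      assume rep: "macaulay_rep d (card (below (Suc m) d u')) j k"
        and kd: "\<forall>c. bot_var u' c \<longrightarrow> c < m \<and> k d = (m - Suc c) + d"
        and cnt: "card (below (Suc m) (Suc d) (inc m u')) = (\<Sum>i=j..d. (k i + 1) choose (i + 1))"
      have jd: "1 \<le> j" "j \<le> d" using rep by (auto simp: macaulay_rep_def)
      then obtain e where "d = Suc e" by (cases d) auto
      then obtain c' where c': "bot_var u' c'" using bot_var_ex[of u' "Suc m" e] u' by blast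
      then have "c \<le> c'" "k d = (m - Suc c') + d" using kd bot' by blast+
      \<comment> \<open>This is why the induction records \<open>k d\<close>: the first variable of
        the quotient is no earlier than \<open>c\<close>, so the new top entry is strictly
        larger.\<close>
      then have kK: "k d < K" unfolding K_def by linarith
      define k' where "k' = k(Suc d := K)"
      have s1: "(\<Sum>i=j..d. k' i choose i) = (\<Sum>i=j..d. k i choose i)"
        by (intro sum.cong) (auto simp: k'_def)
      have s2: "(\<Sum>i=j..d. (k' i + 1) choose (i + 1)) = (\<Sum>i=j..d. (k i + 1) choose (i + 1))"
        by (intro sum.cong) (auto simp: k'_def)
      have "card (below (Suc m) (Suc d) u) = (\<Sum>i=j..Suc d. k' i choose i)"
        using c1 k1 rep s1 jd by (simp add: macaulay_rep_def k'_def del: binomial_Suc_Suc)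
      then have "macaulay_rep (Suc d) (card (below (Suc m) (Suc d) u)) j k'"
        using rep jd kK by (auto simp: macaulay_rep_def k'_def less_Suc_eq)
      moreover have "card (below (Suc m) (Suc (Suc d)) (inc m u)) =
          (\<Sum>i=j..Suc d. (k' i + 1) choose (i + 1))"
        using c2 k2 cnt s2 jd by (simp add: k'_def del: binomial_Suc_Suc)
      moreover have "\<forall>c'. bot_var u c' \<longrightarrow> c' < m \<and> k' (Suc d) = (m - Suc c') + Suc d"
        using cm bot by (auto simp: k'_def K_def)
      ultimately show ?thesis by blast
    qed
  qed
qed

text \<open>Let \<open>u\<close> be the smallest element of \<open>L\<close>. Its multiple by the
  last variable lies in the shadow, so all monomials outside the shadow are below that
  multiple.\<close>

lemma lexseg_eq_mons_minus_below:
  assumes L: "lexseg (Suc m) d L" "L \<noteq> {}"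
  obtains u where "u \<in> mons (Suc m) d" "mons (Suc m) d - L = below (Suc m) d u"
    "mons (Suc m) (Suc d) - shadow (Suc m) L \<subseteq> below (Suc m) (Suc d) (inc m u)"
proof -
  obtain u where u: "u \<in> L" "\<And>v. v \<in> L \<Longrightarrow> v = u \<or> lexless u v"
    using lexless_min[OF lexseg_finite[OF L(1)] L(2)] by blast
  have um: "u \<in> mons (Suc m) d" using u(1) lexseg_mons[OF L(1)] by blast
  have "mons (Suc m) d - L = below (Suc m) d u"
  proof (intro set_eqI iffI)
    fix v assume "v \<in> mons (Suc m) d - L"
    then show "v \<in> below (Suc m) d u" using lexseg_not_in[OF L(1) u(1)] by (auto simp: below_def)
  next
    fix v assume "v \<in> below (Suc m) d u"
    then have v: "v \<in> mons (Suc m) d" "lexless v u" by (auto simp: below_def)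
    then have "v \<notin> L" using u(2)[of v] lexless_asym lexless_irrefl by blast
    then show "v \<in> mons (Suc m) d - L" using v by simp
  qed
  moreover have "inc m u \<in> shadow (Suc m) L" using u(1) by (intro shadowI) auto
  then have "mons (Suc m) (Suc d) - shadow (Suc m) L \<subseteq> below (Suc m) (Suc d) (inc m u)"
    using lexseg_not_in[OF shadow_lexseg[OF L(1)]] by (auto simp: below_def)
  ultimately show ?thesis using that um by blast
qed

theorem card_mons_minus_shadow_lexseg:
  assumes L: "lexseg m d L" and "1 \<le> m" "1 \<le> d"
  shows "card (mons m (Suc d) - shadow m L) \<le> macaulay_op (card (mons m d - L)) d"
proof -
  obtain n where m: "m = Suc n" using assms(2) by (cases m) auto
  show ?thesis
  proof (cases "L = {}")
    case True
    \<comment> \<open>The empty segment has no smallest element; its complement, all monomials, is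
      counted by one binomial coefficient.\<close>
    have "macaulay_rep d ((n + d) choose d) d (\<lambda>_. n + d)" using assms(3) by (simp add: macaulay_rep_def)
    from macaulay_op_eq[OF this] show ?thesis using True by (simp add: m card_mons_eq)
  next
    case False
    then obtain u where u: "u \<in> mons (Suc n) d" "mons (Suc n) d - L = below (Suc n) d u"
      "mons (Suc n) (Suc d) - shadow (Suc n) L \<subseteq> below (Suc n) (Suc d) (inc n u)"
      using lexseg_eq_mons_minus_below[of n d L] L m by blast
    have "card (mons m (Suc d) - shadow m L) \<le> card (below (Suc n) (Suc d) (inc n u))"
      unfolding m using u(3) by (rule card_mono[rotated]) (simp add: below_def)
    also have "\<dots> \<le> macaulay_op (card (below (Suc n) d u)) d"
      using below_macaulay_rep[OF u(1)]
    proof (elim disjE exE conjE)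
      fix j k
      assume rep: "macaulay_rep d (card (below (Suc n) d u)) j k"
        and "card (below (Suc n) (Suc d) (inc n u)) = (\<Sum>i=j..d. (k i + 1) choose (i + 1))"
      then show ?thesis using macaulay_op_eq[OF rep] by simp
    qed simp
    finally show ?thesis unfolding m u(2) .
  qed
qed

section \<open>Passage from paths of monomials to connectedness in \<open>M\<close>\<close>

lemma tau_connected_refl:
  assumes "\<xi> \<in> M \<inter> Gam m d" "\<xi> < \<tau>" shows "tau_connected m d M \<tau> \<xi> \<xi>"
  unfolding tau_connected_def
  by (rule exI[of _ 1], rule exI[of _ "\<lambda>_. \<xi>"]) (use assms in simp)

lemma tau_connected_snoc:
  assumes c: "tau_connected m d M \<tau> \<xi> \<eta>" and z: "\<zeta> \<in> M \<inter> Gam m d" "\<zeta> < \<tau>"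
    and lub: "deg m (sup \<eta> \<zeta>) \<le> d + 1"
  shows "tau_connected m d M \<tau> \<xi> \<zeta>"
proof -
  obtain s f where s: "(1::nat) \<le> s" "\<forall>i\<in>{1..s}. f i \<in> M \<inter> Gam m d \<and> f i < \<tau>"
    "f 1 = \<xi>" "f s = \<eta>" "\<forall>i. 1 \<le> i \<and> i \<le> s - 1 \<longrightarrow> deg m (sup (f i) (f (i + 1))) \<le> d + 1"
    using c unfolding tau_connected_def by blast
  show ?thesis unfolding tau_connected_def
  proof (intro exI[of _ "Suc s"] exI[of _ "f(Suc s := \<zeta>)"] conjI allI impI ballI)
    fix i assume "i \<in> {1..Suc s}"
    then show "(f(Suc s := \<zeta>)) i \<in> M \<inter> Gam m d" "(f(Suc s := \<zeta>)) i < \<tau>"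
      using s(2) z by (auto simp: le_Suc_eq)
  next
    fix i assume i: "1 \<le> i \<and> i \<le> Suc s - 1"
    show "deg m (sup ((f(Suc s := \<zeta>)) i) ((f(Suc s := \<zeta>)) (i + 1))) \<le> d + 1"
    proof (cases "i = s")
      case True
      then show ?thesis using lub s(4) by simp
    next
      case False
      then have "i \<le> s - 1" using i by linarith
      then show ?thesis using s(5) i False by auto
    qed
  qed (use s in auto)
qed

text \<open>Multiply \<xi> by one variable at a time; while the degree is below that of \<tau>, some
  entry has room.\<close>

lemma mons_between:
  assumes "\<xi> \<in> Nvec m" "\<xi> \<le> \<tau>" "deg m \<xi> \<le> d" "d \<le> deg m \<tau>"
  shows "\<exists>u\<in>mons m d. \<xi> \<le> u \<and> u \<le> \<tau>"
  using assms(3,4)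
proof (induction d rule: dec_induct)
  case base
  then show ?case using assms by (auto simp: mons_def)
next
  case (step d)
  then obtain u where u: "u \<in> mons m d" "\<xi> \<le> u" "u \<le> \<tau>" by auto
  have "\<exists>i<m. u i < \<tau> i"
  proof (rule ccontr)
    assume "\<not> ?thesis"
    then have "\<tau> i \<le> u i" if "i < m" for i using that by (meson not_less)
    then have "deg m \<tau> \<le> deg m u" by (intro deg_mono) auto
    then show False using step.prems mons_deg[OF u(1)] by simp
  qed
  then obtain i where i: "i < m" "u i < \<tau> i" by blast
  have "inc i u \<le> \<tau>" using u(3) i by (auto simp: le_fun_def inc_apply)
  moreover have "\<xi> \<le> inc i u" using u(2) by (auto simp: le_fun_def inc_apply intro: le_SucI)
  ultimately show ?case using mons_inc[OF u(1) i(1)] by blast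
qed

text \<open>The degree \<open>d\<close> part of the monomial ideal generated by \<open>M\<close>;
  the Hilbert-Samuel function counts its complement.\<close>

definition multiples :: "nat \<Rightarrow> nat \<Rightarrow> (nat \<Rightarrow> nat) set \<Rightarrow> (nat \<Rightarrow> nat) set" where
  "multiples m d M = {u \<in> mons m d. \<exists>\<eta>\<in>M. \<eta> \<le> u}"

lemma hilbert_samuel_eq: "hilbert_samuel m M d = card (mons m d - multiples m d M)"
  unfolding hilbert_samuel_def by (rule arg_cong[of _ _ card]) (auto simp: mons_def multiples_def)

lemma shadow_multiples: "shadow m (multiples m d M) \<subseteq> multiples m (Suc d) M"
proof
  fix u assume "u \<in> shadow m (multiples m d M)"
  then obtain i v \<eta> where "i < m" "v \<in> mons m d" "u = inc i v" "\<eta> \<in> M" "\<eta> \<le> v"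
    by (auto simp: multiples_def elim: shadowE)
  moreover from this have "\<eta> \<le> inc i v" by (auto simp: le_fun_def inc_apply intro: le_SucI)
  ultimately show "u \<in> multiples m (Suc d) M" by (auto simp: multiples_def mons_inc)
qed

text \<open>Attach to each monomial of the path a divisor in \<open>M\<close>; its degree is at most
  \<open>d\<close>, so it is strictly below \<tau>. Neighbours have a common multiple of degree
  \<open>d + 1\<close>, which bounds the LUB of their divisors. The last divisor stays arbitrary in
  the induction.\<close>

lemma tau_connected_of_adj:
  assumes M: "M \<subseteq> Nvec m" and \<tau>: "d < deg m \<tau>"
    and path: "(adj m (multiples m d M) \<tau>)\<^sup>*\<^sup>* u v" and u: "u \<in> multiples m d M" "u \<le> \<tau>"
    and \<xi>: "\<xi> \<in> M" "\<xi> \<le> u" and \<zeta>: "\<zeta> \<in> M" "\<zeta> \<le> v"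
  shows "tau_connected m d M \<tau> \<xi> \<zeta>"
proof -
  have low: "\<eta> \<in> M \<inter> Gam m d" "\<eta> < \<tau>"
    if "\<eta> \<in> M" "\<eta> \<le> x" "x \<in> multiples m d M" "x \<le> \<tau>" for \<eta> x
  proof -
    have x: "x \<in> mons m d" using that by (simp add: multiples_def)
    have "deg m \<eta> \<le> deg m x" using that(2) by (intro deg_mono) (rule le_funD)
    then have \<eta>d: "deg m \<eta> \<le> d" using mons_deg[OF x] by simp
    then show "\<eta> \<in> M \<inter> Gam m d" using that(1) M by (auto simp: Gam_def)
    have "\<eta> \<noteq> \<tau>" using \<eta>d \<tau> by auto
    then show "\<eta> < \<tau>" using that(2,4) by simp
  qed
  have lub: "deg m (sup \<eta> \<eta>') \<le> deg m y" if "\<eta> \<le> y" "\<eta>' \<le> y" for \<eta> \<eta>' y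
  proof -
    have "sup \<eta> \<eta>' \<le> y" using that by simp
    then show ?thesis by (intro deg_mono) (rule le_funD)
  qed
  have le_inc: "x \<le> inc i x" for x i by (auto simp: le_fun_def inc_apply)
  show ?thesis using path \<zeta>
  proof (induction arbitrary: \<zeta> rule: rtranclp_induct)
    case base
    have "deg m u = d" using u by (simp add: multiples_def mons_deg)
    then have "deg m (sup \<xi> \<zeta>) \<le> d + 1" using lub[OF \<xi>(2) base(2)] by simp
    then show ?case
      using tau_connected_snoc[OF tau_connected_refl[OF low[OF \<xi> u]] low[OF base u]] by blast
  next
    case (step x y)
    have x: "x \<in> multiples m d M" "x \<le> \<tau>" and y: "y \<in> multiples m d M" "y \<le> \<tau>"
      using step(2) by (auto simp: adj_def)
    obtain i j where ij: "i < m" "j < m" "inc i x = inc j y" using step(2) by (auto simp: adj_def)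
    obtain \<eta> where \<eta>: "\<eta> \<in> M" "\<eta> \<le> x" using x by (auto simp: multiples_def)
    have "deg m (sup \<eta> \<zeta>) \<le> deg m (inc i x)"
      using \<eta>(2) step.prems(2) le_inc[of x i] le_inc[of y j] ij(3) by (intro lub) (auto intro: order_trans)
    also have "\<dots> = d + 1" using x ij(1) by (simp add: multiples_def deg_inc mons_deg)
    finally show ?case
      using tau_connected_snoc[OF step.IH[OF \<eta>] low[OF step.prems y]] by blast
  qed
qed

theorem theorem28:
  fixes m d :: nat and M :: "(nat \<Rightarrow> nat) set"
  assumes "m \<ge> 1"
    and "d > 0"
    and "M \<subseteq> Nvec m"
    and "\<exists>\<xi>\<in>M. \<exists>\<zeta>\<in>M. \<xi> \<noteq> \<zeta> \<and> deg m \<xi> \<le> d \<and> deg m \<zeta> \<le> d \<and>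
           \<not> \<xi> \<le> \<zeta> \<and> \<not> \<zeta> \<le> \<xi> \<and>
           deg m (sup \<xi> \<zeta>) > d + 1 \<and>
           \<not> tau_connected m d M (sup \<xi> \<zeta>) \<xi> \<zeta>"
  shows "hilbert_samuel m M (d + 1) < macaulay_op (hilbert_samuel m M d) d"
proof -
  obtain \<xi> \<zeta> where \<xi>: "\<xi> \<in> M" "deg m \<xi> \<le> d" and \<zeta>: "\<zeta> \<in> M" "deg m \<zeta> \<le> d"
    and lub: "deg m (sup \<xi> \<zeta>) > d + 1"
    and not_conn: "\<not> tau_connected m d M (sup \<xi> \<zeta>) \<xi> \<zeta>"
    using assms(4) by blast
  define \<tau> where "\<tau> = sup \<xi> \<zeta>"
  define A where "A = multiples m d M"
  have A: "A \<subseteq> mons m d" by (auto simp: A_def multiples_def)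
  obtain u where u: "u \<in> mons m d" "\<xi> \<le> u" "u \<le> \<tau>"
    using mons_between[of \<xi> m \<tau> d] \<xi> lub assms(3) by (auto simp: \<tau>_def)
  obtain v where v: "v \<in> mons m d" "\<zeta> \<le> v" "v \<le> \<tau>"
    using mons_between[of \<zeta> m \<tau> d] \<zeta> lub assms(3) by (auto simp: \<tau>_def)
  have uA: "u \<in> A" and vA: "v \<in> A" using u v \<xi> \<zeta> by (auto simp: A_def multiples_def)
  have "\<not> min_shadow m d A"
  proof
    assume "min_shadow m d A"
    from min_shadow_connected[OF this uA vA u(3) v(3)]
    have "tau_connected m d M \<tau> \<xi> \<zeta>"
      using tau_connected_of_adj[OF assms(3), of d \<tau> u v \<xi> \<zeta>] lub uA u v \<xi> \<zeta>
      by (simp add: A_def \<tau>_def)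
    then show False using not_conn by (simp add: \<tau>_def)
  qed
  then obtain B where B: "B \<subseteq> mons m d" "card B = card A" "card (shadow m B) < card (shadow m A)"
    using A by (auto simp: min_shadow_def not_le)
  obtain L where L: "lexseg m d L" "card L = card A"
    using lexseg_exists card_mono[OF finite_mons A] by blast
  \<comment> \<open>The strictness of the final inequality comes from here: \<open>A\<close> is
    beaten by some \<open>B\<close>, and \<open>B\<close> is matched or beaten by the
    segment.\<close>
  have "card (shadow m L) < card (shadow m A)"
    using card_shadow_lexseg_le[OF L(1) B(1)] B L(2) by simp
  then have less: "card (mons m (Suc d) - shadow m A) < card (mons m (Suc d) - shadow m L)"
    using card_mono[OF finite_mons shadow_mons[OF A]] shadow_mons[OF A]
      shadow_mons[OF lexseg_mons[OF L(1)]] finite_shadow[OF A] finite_shadow[OF lexseg_mons[OF L(1)]]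
    by (simp add: card_Diff_subset)
  have "hilbert_samuel m M (d + 1) \<le> card (mons m (Suc d) - shadow m A)"
    unfolding hilbert_samuel_eq using shadow_multiples[of m d M]
    by (intro card_mono) (auto simp: A_def)
  also note less
  also have "card (mons m (Suc d) - shadow m L) \<le> macaulay_op (card (mons m d - L)) d"
    using card_mons_minus_shadow_lexseg[OF L(1)] assms(1,2) by simp
  also have "card (mons m d - L) = hilbert_samuel m M d"
    using A L(2) finite_subset[OF A] lexseg_mons[OF L(1)] lexseg_finite[OF L(1)]
    by (simp add: hilbert_samuel_eq A_def[symmetric] card_Diff_subset)
  finally show ?thesis .
qed

end
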